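(* Let $q\neq 2,3,5$ be a prime power. The affine group $\mathrm{Aff}(\mathbb{F}_q)$ has no Lee metrics. Moreover, for a subgroup of $\mathrm{Aff}(\mathbb{F}_q)$ of the form $G=\mathbb{F}_q\rtimes H$ with $H$ a subgroup of $\mathbb{F}_q^*$ we have: (a) If $q$ is even, then $G$ has Lee metrics if and only if $H=\{1\}$. (b) Let $q$ be odd. If $H=\{1\}$, then $G$ has Lee metrics if and only if $q$ is prime. If $H\simeq\mathbb{Z}_2$ and $q$ is prime, then $G$ has Lee metrics. If $H\not\simeq\{1\},\mathbb{Z}_2,\mathbb{Z}_4$, then $G$ has no Lee metrics.
   Context: $\mathbb{F}_q$ is the finite field with $q$ elements and $\mathbb{F}_q^*$ its multiplicative group. $\mathrm{Aff}(\mathbb{F}_q)=\mathbb{F}_q\rtimes\mathbb{F}_q^*$ is the group of matrices $\begin{pmatrix} a&b\\0&1\end{pmatrix}$ with $a\in\mathbb{F}_q^*$, $b\in\mathbb{F}_q$ under multiplication, and $\mathbb{F}_q\rtimes H$ is the subgroup of those matrices with $a\in H$. All metrics on groups are integral (integer valued) and right translation invariant: $d(gh,g'h)=d(g,g')$ for all $g,g',h\in G$. The weight of $d$ is $w(x)=d(x,e)$, $e$ the identity of $G$. The partition induced by $d$, denoted $P(G,d)$, is the set of classes of the equivalence relation $g\sim h\Leftrightarrow w(g)=w(h)$. An interval metric is such a metric $d$ with finitely many weights and without gaps: if $P(G,d)$ has $n$ parts different from $\{e\}$, then the set of values of $w$ is exactly $\{0,1,\ldots,n\}$. The Lee partition of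 $G$ is $\mathcal{P}_{Lee}(G)=\{\{a,a^{-1}\}:a\in G\}$. A Lee metric on $G$ is an interval metric $d$ on $G$ with $P(G,d)=\mathcal{P}_{Lee}(G)$. *)

theory Defs
  imports
    "HOL-Analysis.Abstract_Metric_Spaces"
    "HOL-Number_Theory.Prime_Powers"
    "HOL-Algebra.Multiplicative_Group"
    "HOL-Algebra.Elementary_Groups"
begin

section \<open>Metrics on groups\<close>

text \<open>The locale \<^term>\<open>Metric_space\<close> constrains a metric to be symmetric and nonnegative also
  outside the carrier; values outside the carrier are irrelevant below.\<close>

definition group_metric :: "('a, 'm) monoid_scheme \<Rightarrow> ('a \<Rightarrow> 'a \<Rightarrow> real) \<Rightarrow> bool" where
  "group_metric G d \<longleftrightarrow>
     Metric_space (carrier G) d \<and>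
     (\<forall>g\<in>carrier G. \<forall>h\<in>carrier G. d g h \<in> \<int>) \<and>
     (\<forall>g\<in>carrier G. \<forall>g'\<in>carrier G. \<forall>h\<in>carrier G.
        d (g \<otimes>\<^bsub>G\<^esub> h) (g' \<otimes>\<^bsub>G\<^esub> h) = d g g')"

definition weight :: "('a, 'm) monoid_scheme \<Rightarrow> ('a \<Rightarrow> 'a \<Rightarrow> real) \<Rightarrow> 'a \<Rightarrow> real" where
  "weight G d x = d x \<one>\<^bsub>G\<^esub>"

definition metric_partition :: "('a, 'm) monoid_scheme \<Rightarrow> ('a \<Rightarrow> 'a \<Rightarrow> real) \<Rightarrow> 'a set set" where
  "metric_partition G d =
     carrier G // {(g, h). g \<in> carrier G \<and> h \<in> carrier G \<and> weight G d g = weight G d h}"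

text \<open>Finiteness of the set of weights is stated separately because the cardinality of an
  infinite set is 0.\<close>

definition interval_metric :: "('a, 'm) monoid_scheme \<Rightarrow> ('a \<Rightarrow> 'a \<Rightarrow> real) \<Rightarrow> bool" where
  "interval_metric G d \<longleftrightarrow>
     group_metric G d \<and>
     finite (weight G d ` carrier G) \<and>
     weight G d ` carrier G = real ` {0..card (metric_partition G d - {{\<one>\<^bsub>G\<^esub>}})}"

definition lee_partition :: "('a, 'm) monoid_scheme \<Rightarrow> 'a set set" where
  "lee_partition G = {{a, inv\<^bsub>G\<^esub> a} | a. a \<in> carrier G}"

definition lee_metric :: "('a, 'm) monoid_scheme \<Rightarrow> ('a \<Rightarrow> 'a \<Rightarrow> real) \<Rightarrow> bool" where
  "lee_metric G d \<longleftrightarrow> interval_metric G d \<and> metric_partition G d = lee_partition G"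

definition has_lee_metric :: "('a, 'm) monoid_scheme \<Rightarrow> bool" where
  "has_lee_metric G \<longleftrightarrow> (\<exists>d. lee_metric G d)"

section \<open>Affine groups\<close>

text \<open>A 2 by 2 matrix is the pair of its rows.\<close>

type_synonym 'a mat2 = "('a \<times> 'a) \<times> ('a \<times> 'a)"

fun mat2_mult :: "('a, 'm) ring_scheme \<Rightarrow> 'a mat2 \<Rightarrow> 'a mat2 \<Rightarrow> 'a mat2" where
  "mat2_mult F ((a, b), (c, d)) ((a', b'), (c', d')) =
     ((a \<otimes>\<^bsub>F\<^esub> a' \<oplus>\<^bsub>F\<^esub> b \<otimes>\<^bsub>F\<^esub> c', a \<otimes>\<^bsub>F\<^esub> b' \<oplus>\<^bsub>F\<^esub> b \<otimes>\<^bsub>F\<^esub> d'),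
      (c \<otimes>\<^bsub>F\<^esub> a' \<oplus>\<^bsub>F\<^esub> d \<otimes>\<^bsub>F\<^esub> c', c \<otimes>\<^bsub>F\<^esub> b' \<oplus>\<^bsub>F\<^esub> d \<otimes>\<^bsub>F\<^esub> d'))"

text \<open>The group of matrices with rows \<^emph>\<open>(a, b)\<close>, \<^emph>\<open>(0, 1)\<close> with \<^emph>\<open>a\<close> in \<^emph>\<open>H\<close> and \<^emph>\<open>b\<close> in \<^emph>\<open>F\<close>.\<close>

definition affine_subgroup :: "('a, 'm) ring_scheme \<Rightarrow> 'a set \<Rightarrow> 'a mat2 monoid" where
  "affine_subgroup F H =
     \<lparr>carrier = {((a, b), (\<zero>\<^bsub>F\<^esub>, \<one>\<^bsub>F\<^esub>)) | a b. a \<in> H \<and> b \<in> carrier F},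
      mult = mat2_mult F,
      one = ((\<one>\<^bsub>F\<^esub>, \<zero>\<^bsub>F\<^esub>), (\<zero>\<^bsub>F\<^esub>, \<one>\<^bsub>F\<^esub>))\<rparr>"

definition affine_group :: "('a, 'm) ring_scheme \<Rightarrow> 'a mat2 monoid" where
  "affine_group F = affine_subgroup F (carrier (mult_of F))"

lemma group_affine_subgroup:
  fixes F (structure)
  assumes "field F" and H: "subgroup H (mult_of F)"
  shows "group (affine_subgroup F H)"
proof -
  interpret field F by fact
  interpret M: group "mult_of F" by (rule field_mult_group)
  interpret H: subgroup H "mult_of F" by fact
  have sub: "\<And>a. a \<in> H \<Longrightarrow> a \<in> carrier F"
    using H.subset by auto
  have mul: "\<And>a b. a \<in> H \<Longrightarrow> b \<in> H \<Longrightarrow> a \<otimes> b \<in> H"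
    using H.m_closed by simp
  have one: "\<one> \<in> H"
    using H.one_closed by simp
  have inv_ex: "\<exists>a'\<in>H. a' \<otimes> a = \<one>" if "a \<in> H" for a
    using that H.m_inv_closed[of a] M.l_inv[of a] H.subset by fastforce
  show ?thesis
  proof (rule groupI)
    fix x assume "x \<in> carrier (affine_subgroup F H)"
    then obtain a b where x: "x = ((a, b), (\<zero>, \<one>))" "a \<in> H" "b \<in> carrier F"
      by (auto simp: affine_subgroup_def)
    from inv_ex[OF x(2)] obtain a' where a': "a' \<in> H" "a' \<otimes> a = \<one>" by blast
    show "\<exists>y\<in>carrier (affine_subgroup F H).
            y \<otimes>\<^bsub>affine_subgroup F H\<^esub> x = \<one>\<^bsub>affine_subgroup F H\<^esub>"
      using x a' sub
      by (intro bexI[of _ "((a', \<ominus> (a' \<otimes> b)), (\<zero>, \<one>))"])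
         (auto simp: affine_subgroup_def r_neg)
  qed (auto simp: affine_subgroup_def sub mul one r_distr m_assoc a_assoc)
qed

end

(*
A Lee metric is the same as a subadditive weight w with values 0, ..., n that separates exactly the
sets {x, x^-1}. If w a = 1, K is a subgroup containing a and d has minimal weight outside K, then
a d and d a lie outside K and have weight w d or w d + 1, so both are among d^-1, c, c^-1 for a
single c. This is very restrictive. For commutative G of odd order it forces G to be generated by a.
In F x| H with H nontrivial, commuting is transitive on nontrivial elements; taking for K the
centralizer of a, one finds that a and d are noncommuting involutions, which is impossible in
characteristic 2. In odd characteristic, d moreover turns out to have weight 2, and the same
argument with K the subgroup of matrices whose upper left entry is a fourth root of unity, now
multiplying by both weight 1 and weight 2 elements, forces H to have exponent dividing 4.

Conversely, for q = p an odd prime, the translations act on the circle Z/p, and the dihedral group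
acts on the circle Z/3p so that the origin has trivial stabilizer; the weight of g is the distance by
which g moves the origin.
*)

theory Submission
  imports Defs
begin

section \<open>Lee weights on groups\<close>

text \<open>A right invariant metric is recovered from its weight by d(x, y) = w(x y^-1), and its
  triangle inequality becomes subadditivity. Symmetry and vanishing exactly at the identity follow
  from these clauses.\<close>

definition lee_weight :: "('a, 'm) monoid_scheme \<Rightarrow> ('a \<Rightarrow> nat) \<Rightarrow> bool" where
  "lee_weight G w \<longleftrightarrow>
     (\<forall>x\<in>carrier G. \<forall>y\<in>carrier G. w (x \<otimes>\<^bsub>G\<^esub> y) \<le> w x + w y) \<and>
     (\<forall>x\<in>carrier G. \<forall>y\<in>carrier G. w x = w y \<longleftrightarrow> y = x \<or> y = inv\<^bsub>G\<^esub> x) \<and>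
     (\<exists>n. w ` carrier G = {0..n})"

text \<open>These are the groups in which every nontrivial element has a commutative
  centralizer.\<close>

definition commutation_transitive :: "('a, 'm) monoid_scheme \<Rightarrow> bool" where
  "commutation_transitive G \<longleftrightarrow>
     (\<forall>x\<in>carrier G - {\<one>\<^bsub>G\<^esub>}. \<forall>y\<in>carrier G. \<forall>z\<in>carrier G.
        x \<otimes>\<^bsub>G\<^esub> y = y \<otimes>\<^bsub>G\<^esub> x \<longrightarrow> x \<otimes>\<^bsub>G\<^esub> z = z \<otimes>\<^bsub>G\<^esub> x \<longrightarrow> y \<otimes>\<^bsub>G\<^esub> z = z \<otimes>\<^bsub>G\<^esub> y)"

lemma lee_weightI:
  assumes "\<And>x y. x \<in> carrier G \<Longrightarrow> y \<in> carrier G \<Longrightarrow> w (x \<otimes>\<^bsub>G\<^esub> y) \<le> w x + w y"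
    and "\<And>x y. x \<in> carrier G \<Longrightarrow> y \<in> carrier G \<Longrightarrow> w x = w y \<longleftrightarrow> y = x \<or> y = inv\<^bsub>G\<^esub> x"
    and "w ` carrier G = {0..n}"
  shows "lee_weight G w"
  unfolding lee_weight_def using assms by (intro conjI ballI exI[of _ n])

section \<open>Elementary properties of Lee weights\<close>

context group
begin

lemma inv_mult_cancel:
  assumes "x \<in> carrier G" "y \<in> carrier G"
  shows "inv x \<otimes> (x \<otimes> y) = y" "x \<otimes> (inv x \<otimes> y) = y"
  using assms by (simp_all flip: m_assoc)

lemma commutation_transitiveD:
  "commutation_transitive G \<Longrightarrow> x \<in> carrier G \<Longrightarrow> y \<in> carrier G \<Longrightarrow> z \<in> carrier G \<Longrightarrow> x \<noteq> \<one> \<Longrightarrow>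
    x \<otimes> y = y \<otimes> x \<Longrightarrow> x \<otimes> z = z \<otimes> x \<Longrightarrow> y \<otimes> z = z \<otimes> y"
  unfolding commutation_transitive_def by blast

lemma lee_weight_mult:
  "lee_weight G w \<Longrightarrow> x \<in> carrier G \<Longrightarrow> y \<in> carrier G \<Longrightarrow> w (x \<otimes> y) \<le> w x + w y"
  by (simp add: lee_weight_def)

lemma lee_weight_eq_iff:
  "lee_weight G w \<Longrightarrow> x \<in> carrier G \<Longrightarrow> y \<in> carrier G \<Longrightarrow> w x = w y \<longleftrightarrow> y = x \<or> y = inv x"
  by (simp add: lee_weight_def)

lemma lee_weight_inv:
  "lee_weight G w \<Longrightarrow> x \<in> carrier G \<Longrightarrow> w (inv x) = w x"
  by (metis inv_closed lee_weight_eq_iff)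

lemma lee_weight_image:
  "lee_weight G w \<Longrightarrow> \<exists>n. w ` carrier G = {0..n}"
  by (simp add: lee_weight_def)

text \<open>The value 0 is attained at some \<open>x\<close>, and then x x^-1 has weight at most 0 +
  0.\<close>

lemma lee_weight_one:
  assumes "lee_weight G w"
  shows "w \<one> = 0"
proof -
  obtain n where "w ` carrier G = {0..n}"
    using lee_weight_image[OF assms(1)] by blast
  then have "0 \<in> w ` carrier G" by simp
  then obtain x where "x \<in> carrier G" "w x = 0" by (metis imageE)
  then show ?thesis
    using lee_weight_mult[OF assms, of x "inv x"] lee_weight_inv[OF assms] by simp
qed

lemma lee_weight_eq_0_iff:
  "lee_weight G w \<Longrightarrow> x \<in> carrier G \<Longrightarrow> w x = 0 \<longleftrightarrow> x = \<one>"
  by (metis inv_one lee_weight_eq_iff lee_weight_one one_closed)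

text \<open>The absence of gaps supplies the elements of weight 1 and 2 on which the nonexistence
  proofs rest.\<close>

lemma lee_weight_obtains:
  assumes "lee_weight G w" "x \<in> carrier G" "k \<le> w x"
  obtains y where "y \<in> carrier G" "w y = k"
proof -
  obtain n where n: "w ` carrier G = {0..n}"
    using lee_weight_image[OF assms(1)] by blast
  then have "w x \<le> n" using assms(2) by (metis atLeastAtMost_iff imageI)
  then have "k \<in> w ` carrier G" using n assms(3) by auto
  then show thesis using that by (metis imageE)
qed

section \<open>Elements of minimal weight outside a subgroup\<close>

lemma minimal_weight_outside:
  fixes w :: "'a \<Rightarrow> nat"
  assumes "subgroup K G" "K \<noteq> carrier G"
  obtains d where "d \<in> carrier G" "d \<notin> K"
    "\<And>y. y \<in> carrier G \<Longrightarrow> y \<notin> K \<Longrightarrow> w d \<le> w y"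
proof -
  obtain x where "x \<in> carrier G \<and> x \<notin> K"
    using assms subgroup.subset[OF assms(1)] by blast
  from ex_has_least_nat[of "\<lambda>x. x \<in> carrier G \<and> x \<notin> K", OF this, of w]
  show thesis using that by metis
qed

lemma subgroup_centralizer_element:
  assumes a: "a \<in> carrier G"
  shows "subgroup {x \<in> carrier G. a \<otimes> x = x \<otimes> a} G"
proof
  fix x assume "x \<in> {x \<in> carrier G. a \<otimes> x = x \<otimes> a}"
  then have x: "x \<in> carrier G" "a \<otimes> x = x \<otimes> a" by auto
  have "a = x \<otimes> (a \<otimes> inv x)"
    using x a by (metis inv_closed inv_solve_right m_assoc m_closed)
  then have "inv x \<otimes> a = a \<otimes> inv x"
    using x(1) a inv_mult_cancel(1)[OF x(1), of "a \<otimes> inv x"] by (metis inv_closed m_closed)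
  then show "inv x \<in> {x \<in> carrier G. a \<otimes> x = x \<otimes> a}" using x by simp
qed (use a in \<open>auto simp: m_assoc, metis m_assoc\<close>)

lemma in_subgroup_cancel:
  assumes "subgroup K G" "x \<in> K" "d \<in> carrier G"
  shows "x \<otimes> d \<in> K \<longleftrightarrow> d \<in> K" "d \<otimes> x \<in> K \<longleftrightarrow> d \<in> K"
proof -
  interpret K: subgroup K G by fact
  have x: "x \<in> carrier G" using assms by auto
  have "inv x \<otimes> (x \<otimes> d) = d" "d \<otimes> x \<otimes> inv x = d"
    using x assms(3) by (simp_all add: m_assoc inv_mult_cancel)
  then show "x \<otimes> d \<in> K \<longleftrightarrow> d \<in> K" "d \<otimes> x \<in> K \<longleftrightarrow> d \<in> K"
    by (metis K.m_closed K.m_inv_closed assms(2))+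
qed

text \<open>The products stay outside \<open>K\<close>, so minimality bounds their weight from below
  and subadditivity from above. If \<open>x\<close> has weight 1 or 2, only two or three values
  remain, each taken by at most two elements.\<close>

lemma weight_outside_bounds:
  assumes w: "lee_weight G w" and K: "subgroup K G" and x: "x \<in> K"
    and d: "d \<in> carrier G" "d \<notin> K" "\<And>y. y \<in> carrier G \<Longrightarrow> y \<notin> K \<Longrightarrow> w d \<le> w y"
  shows "w d \<le> w (x \<otimes> d)" "w (x \<otimes> d) \<le> w d + w x"
    "w d \<le> w (d \<otimes> x)" "w (d \<otimes> x) \<le> w d + w x"
proof -
  have xG: "x \<in> carrier G" using K x by (rule subgroup.mem_carrier)
  show "w (x \<otimes> d) \<le> w d + w x" "w (d \<otimes> x) \<le> w d + w x"
    using lee_weight_mult[OF w xG d(1)] lee_weight_mult[OF w d(1) xG] by simp_all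
  show "w d \<le> w (x \<otimes> d)" "w d \<le> w (d \<otimes> x)"
    using d(3) in_subgroup_cancel[OF K x d(1)] xG d(1,2) by simp_all
qed

text \<open>Either equation makes \<open>a\<close> the inverse of the square of \<open>d\<close>,
  hence a power of \<open>d\<close>.\<close>

lemma mult_eq_inv_imp_commute:
  assumes "a \<in> carrier G" "d \<in> carrier G" "a \<otimes> d = inv d \<or> d \<otimes> a = inv d"
  shows "a \<otimes> d = d \<otimes> a"
proof -
  have "a = inv (d \<otimes> d)"
    using assms inv_solve_left[of a d "inv d"] inv_solve_right[of a "inv d" d]
    by (auto simp: inv_mult_group)
  then show ?thesis
    using assms by (simp add: inv_mult_group m_assoc inv_mult_cancel)
qed

text \<open>Of the two weights left for the products, \<open>w d\<close> is taken only by
  \<open>d\<close> and \<open>inv d\<close>, and a product equal to \<open>d\<close> would force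
  \<open>a = \<one>\<close>.\<close>

lemma weight_one_times_minimal:
  assumes w: "lee_weight G w" and a: "w a = 1" and K: "subgroup K G" "a \<in> K"
    and d: "d \<in> carrier G" "d \<notin> K" "\<And>y. y \<in> carrier G \<Longrightarrow> y \<notin> K \<Longrightarrow> w d \<le> w y"
  shows "w (a \<otimes> d) = w d + 1 \<or> a \<otimes> d = inv d"
    and "w (d \<otimes> a) = w d + 1 \<or> d \<otimes> a = inv d"
proof -
  have aG: "a \<in> carrier G" using K by (rule subgroup.mem_carrier)
  have "a \<noteq> \<one>" using lee_weight_one[OF w] a by auto
  then have ne: "a \<otimes> d \<noteq> d" "d \<otimes> a \<noteq> d" using aG d(1) by (auto simp: l_cancel_one r_cancel_one)
  show "w (a \<otimes> d) = w d + 1 \<or> a \<otimes> d = inv d"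
    using weight_outside_bounds[OF w K d] lee_weight_eq_iff[OF w d(1), of "a \<otimes> d"] ne a aG d(1)
    by fastforce
  show "w (d \<otimes> a) = w d + 1 \<or> d \<otimes> a = inv d"
    using weight_outside_bounds[OF w K d] lee_weight_eq_iff[OF w d(1), of "d \<otimes> a"] ne a aG d(1)
    by fastforce
qed

text \<open>Without commutation neither product can be \<open>inv d\<close>, so both have weight
  \<open>w d + 1\<close>. Elements of equal weight are equal or mutually inverse, and equality is
  excluded.\<close>

lemma weight_one_times_minimal_noncommuting:
  assumes w: "lee_weight G w" and a: "w a = 1" and K: "subgroup K G" "a \<in> K"
    and d: "d \<in> carrier G" "d \<notin> K" "\<And>y. y \<in> carrier G \<Longrightarrow> y \<notin> K \<Longrightarrow> w d \<le> w y"
    and nc: "a \<otimes> d \<noteq> d \<otimes> a"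
  shows "w (a \<otimes> d) = w d + 1" "w (d \<otimes> a) = w d + 1" "d \<otimes> a = inv (a \<otimes> d)"
proof -
  have aG: "a \<in> carrier G" using K by (rule subgroup.mem_carrier)
  show *: "w (a \<otimes> d) = w d + 1" "w (d \<otimes> a) = w d + 1"
    using weight_one_times_minimal[OF w a K d] mult_eq_inv_imp_commute[OF aG d(1)] nc by blast+
  show "d \<otimes> a = inv (a \<otimes> d)"
    using lee_weight_eq_iff[OF w, of "a \<otimes> d" "d \<otimes> a"] * nc aG d(1) by auto
qed

section \<open>Groups in which commuting is transitive\<close>

text \<open>Take \<open>a\<close> of weight 1 and \<open>d\<close> of minimal weight outside its
  centralizer. As a d and d a are mutually inverse, so are the squares of \<open>a\<close> and
  \<open>d\<close>. Hence the square of \<open>a\<close> commutes with both elements; were it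
  nontrivial, transitivity would make \<open>a\<close> and \<open>d\<close> commute.\<close>

lemma lee_weight_noncommuting_involutions:
  assumes w: "lee_weight G w"
    and ct: "commutation_transitive G"
    and g: "g \<in> carrier G" "h \<in> carrier G" "g \<otimes> h \<noteq> h \<otimes> g"
  obtains a d where "a \<in> carrier G" "w a = 1" "a \<otimes> a = \<one>"
    "d \<in> carrier G" "d \<otimes> d = \<one>" "a \<otimes> d \<noteq> d \<otimes> a"
    "w (a \<otimes> d) = w d + 1" "w (d \<otimes> a) = w d + 1"
    "\<And>y. y \<in> carrier G \<Longrightarrow> a \<otimes> y \<noteq> y \<otimes> a \<Longrightarrow> w d \<le> w y"
proof -
  note trans = commutation_transitiveD[OF ct]
  have "g \<noteq> \<one>" using g by auto
  then have "1 \<le> w g" using lee_weight_eq_0_iff[OF w g(1)] by simp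
  then obtain a where a: "a \<in> carrier G" "w a = 1"
    using lee_weight_obtains[OF w g(1)] by blast
  then have ane: "a \<noteq> \<one>" using lee_weight_one[OF w] by auto
  define K where "K = {x \<in> carrier G. a \<otimes> x = x \<otimes> a}"
  have K: "subgroup K G" "a \<in> K"
    unfolding K_def using subgroup_centralizer_element a by auto
  \<comment> \<open>Otherwise \<open>g\<close> and \<open>h\<close> would both commute with the
    nontrivial \<open>a\<close>, hence with each other.\<close>
  have "K \<noteq> carrier G"
    using trans[OF a(1) g(1,2) ane] g unfolding K_def by blast
  from minimal_weight_outside[OF K(1) this, of w]
  obtain d where d: "d \<in> carrier G" "d \<notin> K" "\<And>y. y \<in> carrier G \<Longrightarrow> y \<notin> K \<Longrightarrow> w d \<le> w y"
    by blast
  have nc: "a \<otimes> d \<noteq> d \<otimes> a" using d unfolding K_def by blast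
  note min = weight_one_times_minimal_noncommuting[OF w a(2) K d nc]
  have adda: "a \<otimes> d \<otimes> (d \<otimes> a) = \<one>" using min(3) a(1) d(1) by simp
  have aa: "a \<otimes> a = inv (d \<otimes> d)"
  proof -
    have "d \<otimes> d = inv a \<otimes> (a \<otimes> d \<otimes> (d \<otimes> a)) \<otimes> inv a"
      using a(1) d(1) by (simp add: m_assoc inv_mult_cancel)
    also have "\<dots> = inv (a \<otimes> a)" using adda a(1) by (simp add: inv_mult_group)
    finally show ?thesis using a(1) by simp
  qed
  have "a \<otimes> a = \<one>"
  proof (rule ccontr)
    assume ne: "a \<otimes> a \<noteq> \<one>"
    have "(a \<otimes> a) \<otimes> d = d \<otimes> (a \<otimes> a)"
      unfolding aa using d(1) by (simp add: inv_mult_group m_assoc inv_mult_cancel)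
    then have "a \<otimes> d = d \<otimes> a"
      using trans[OF _ a(1) d(1) ne] a(1) by (simp add: m_assoc)
    with nc show False ..
  qed
  moreover have "d \<otimes> d = \<one>"
    using aa calculation d(1) by (metis inv_eq_1_iff m_closed)
  ultimately show thesis
    using that[of a d] a d nc min(1,2) unfolding K_def by blast
qed

text \<open>The subgroup \<open>K\<close> absorbs all elements of order dividing 4, hence those \<open>d\<close> that could
  satisfy \<open>a \<otimes> d = inv d\<close> for an involution \<open>a\<close>.\<close>

lemma not_lee_weight_if_commutation_transitive:
  assumes ct: "commutation_transitive G"
    and invol: "\<And>x y. x \<in> carrier G \<Longrightarrow> y \<in> carrier G \<Longrightarrow> x \<noteq> \<one> \<Longrightarrow> y \<noteq> \<one> \<Longrightarrow>
      x \<otimes> x = \<one> \<Longrightarrow> y \<otimes> y = \<one> \<Longrightarrow> x \<otimes> y = y \<otimes> x \<Longrightarrow> x = y"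
    and K: "subgroup K G" "K \<noteq> carrier G"
      "\<And>x. x \<in> carrier G \<Longrightarrow> (x \<otimes> x) \<otimes> (x \<otimes> x) = \<one> \<Longrightarrow> x \<in> K"
    and g: "g \<in> carrier G" "h \<in> carrier G" "g \<otimes> h \<noteq> h \<otimes> g"
  shows "\<not> lee_weight G w"
proof
  assume w: "lee_weight G w"
  note trans = commutation_transitiveD[OF ct]
  obtain a b where a: "a \<in> carrier G" "w a = 1" "a \<otimes> a = \<one>"
    and b: "b \<in> carrier G" "b \<otimes> b = \<one>" "a \<otimes> b \<noteq> b \<otimes> a"
      "w (a \<otimes> b) = w b + 1" "w (b \<otimes> a) = w b + 1"
      "\<And>y. y \<in> carrier G \<Longrightarrow> a \<otimes> y \<noteq> y \<otimes> a \<Longrightarrow> w b \<le> w y"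
    using lee_weight_noncommuting_involutions[OF w ct g] by blast
  have ane: "a \<noteq> \<one>" using a lee_weight_one[OF w] by auto
  have invb: "inv b = b" using b by (simp add: inv_equality)
  have inva: "inv a = a" using a by (simp add: inv_equality)
  \<comment> \<open>Otherwise some \<open>x\<close> of weight 2 is lighter than \<open>b\<close> and
    so commutes with \<open>a\<close>. The products of \<open>x\<close> and \<open>b\<close> have
    weight at most \<open>w b + 2\<close>, and the two smaller values are taken only by
    \<open>b\<close>, \<open>a \<otimes> b\<close> and \<open>b \<otimes> a\<close>. So both
    products have weight \<open>w b + 2\<close> and are mutually inverse, which makes
    \<open>x\<close> an involution.\<close>
  have wb: "w b = 2"
  proof (rule ccontr)
    assume "w b \<noteq> 2"
    moreover have "b \<noteq> \<one>" "w b \<noteq> w a"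
      using b(1,3) a(1) inva lee_weight_eq_iff[OF w b(1) a(1)] invb by auto
    ultimately have "2 < w b" using a(2) lee_weight_eq_0_iff[OF w b(1)] by linarith
    then obtain x where x: "x \<in> carrier G" "w x = 2"
      using lee_weight_obtains[OF w b(1), of 2] by auto
    have ax: "a \<otimes> x = x \<otimes> a" using b(6)[OF x(1)] \<open>2 < w b\<close> x(2) by auto
    have xa: "x \<noteq> a" using x a by auto
    have xne: "x \<noteq> \<one>" using x lee_weight_one[OF w] by auto
    \<comment> \<open>By \<open>invol\<close>, \<open>a\<close> is the only involution in its own
      centralizer.\<close>
    have xx: "x \<otimes> x \<noteq> \<one>" using invol[OF a(1) x(1) ane xne a(3) _ ax] xa by blast
    have xb: "x \<otimes> b \<noteq> b \<otimes> x" using trans[OF x(1) a(1) b(1) xne] ax b(3) by auto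
    define C where "C = {x \<in> carrier G. a \<otimes> x = x \<otimes> a}"
    have C: "subgroup C G" "x \<in> C" "b \<notin> C"
      unfolding C_def using subgroup_centralizer_element a(1) b(3) ax x(1) by auto
    have bmin: "\<And>y. y \<in> carrier G \<Longrightarrow> y \<notin> C \<Longrightarrow> w b \<le> w y"
      using b(6) unfolding C_def by blast
    note bounds = weight_outside_bounds[OF w C(1,2) b(1) C(3) bmin, unfolded x(2)]
    \<comment> \<open>A conjugate of \<open>a\<close> is an involution, while \<open>x\<close> is
      not. This later excludes \<open>x \<otimes> b = b \<otimes> a\<close> and
      \<open>b \<otimes> x = a \<otimes> b\<close>.\<close>
    have bab: "x \<noteq> b \<otimes> a \<otimes> b"
    proof
      assume "x = b \<otimes> a \<otimes> b"
      then have "x \<otimes> x = b \<otimes> a \<otimes> (b \<otimes> b) \<otimes> a \<otimes> b" using a(1) b(1) by (simp add: m_assoc)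
      also have "\<dots> = b \<otimes> (a \<otimes> a) \<otimes> b" using a(1) b(1) unfolding b(2) by (simp add: m_assoc)
      also have "\<dots> = \<one>" using a b(1,2) by simp
      finally show False using xx by simp
    qed
    have mab: "b \<otimes> a = inv (a \<otimes> b)" using inva invb a b by (simp add: inv_mult_group)
    have w1: "y = a \<otimes> b \<or> y = b \<otimes> a" if "w y = w b + 1" "y \<in> carrier G" for y
      using lee_weight_eq_iff[OF w, of "a \<otimes> b" y] that a b mab by auto
    have w0: "y = b" if "w y = w b" "y \<in> carrier G" for y
      using lee_weight_eq_iff[OF w, of b y] that b invb by auto
    have "x \<otimes> b \<noteq> b" "b \<otimes> x \<noteq> b" using xne x(1) b(1) by (auto simp: l_cancel_one r_cancel_one)
    moreover have "x \<otimes> b \<noteq> a \<otimes> b" "b \<otimes> x \<noteq> b \<otimes> a" using xa a(1) x(1) b(1) by auto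
    moreover have "x \<otimes> b \<noteq> b \<otimes> a"
      using bab invb x(1) a(1) b(1) by (metis inv_solve_right m_closed)
    moreover have "b \<otimes> x \<noteq> a \<otimes> b"
      using bab invb x(1) a(1) b(1) by (metis inv_solve_left m_assoc m_closed)
    ultimately have "w (x \<otimes> b) \<noteq> w b" "w (b \<otimes> x) \<noteq> w b" "w (x \<otimes> b) \<noteq> w b + 1" "w (b \<otimes> x) \<noteq> w b + 1"
      using w0 w1 x(1) b(1) by (meson m_closed)+
    then have "w (x \<otimes> b) = w (b \<otimes> x)" using bounds by linarith
    then have "b \<otimes> x = inv (x \<otimes> b)"
      using lee_weight_eq_iff[OF w, of "x \<otimes> b" "b \<otimes> x"] xb x(1) b(1) by auto
    then have "b \<otimes> x = b \<otimes> inv x" using invb x(1) b(1) by (simp add: inv_mult_group)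
    then have "x = inv x" using x(1) b(1) by simp
    then show False using xx x(1) by (metis r_inv)
  qed
  obtain d where d: "d \<in> carrier G" "d \<notin> K" "\<And>y. y \<in> carrier G \<Longrightarrow> y \<notin> K \<Longrightarrow> w d \<le> w y"
    using minimal_weight_outside[OF K(1,2)] by blast
  have aK: "a \<in> K" "b \<in> K" using K(3) a b by auto
  \<comment> \<open>In either case the fourth power of \<open>d\<close> would be trivial and
    \<open>d\<close> would lie in \<open>K\<close>.\<close>
  have dd: "d \<otimes> d \<noteq> \<one>" "d \<otimes> d \<noteq> a" using K(3)[OF d(1)] d(2) a by auto
  have dne: "d \<noteq> \<one>" using dd d(1) by auto
  \<comment> \<open>Otherwise \<open>d \<otimes> a\<close> is the inverse of
    \<open>a \<otimes> d\<close>, namely \<open>inv d \<otimes> a\<close>, so \<open>d\<close> is an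
    involution.\<close>
  have ad: "a \<otimes> d = d \<otimes> a"
  proof (rule ccontr)
    assume nc: "a \<otimes> d \<noteq> d \<otimes> a"
    from weight_one_times_minimal_noncommuting(3)[OF w a(2) K(1) aK(1) d nc]
    have "d \<otimes> a = inv d \<otimes> a" using a(1) d(1) inva by (simp add: inv_mult_group)
    then have "d = inv d" using a(1) d(1) by simp
    then show False using dd d(1) by (metis r_inv)
  qed
  have "a \<otimes> d \<noteq> inv d"
  proof
    assume "a \<otimes> d = inv d"
    then have "a \<otimes> (d \<otimes> d) = \<one>" using a(1) d(1) by (metis l_inv m_assoc)
    then have "d \<otimes> d = a" using inva a(1) d(1) by (metis inv_equality inv_comm m_closed)
    with dd show False by simp
  qed
  then have wad: "w (a \<otimes> d) = w d + 1"
    using weight_one_times_minimal(1)[OF w a(2) K(1) aK(1) d] by simp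
  have bd: "b \<otimes> d \<noteq> d \<otimes> b" using trans[OF d(1) a(1) b(1) dne] ad b(3) by auto
  \<comment> \<open>The weights \<open>w d\<close> and \<open>w d + 1\<close> are used up by
    \<open>d\<close>, \<open>a \<otimes> d\<close> and their inverses, all of which commute with
    \<open>a\<close>.\<close>
  have low: "a \<otimes> y = y \<otimes> a" if "w y = w d \<or> w y = w d + 1" "y \<in> carrier G" for y
  proof -
    define C where "C = {x \<in> carrier G. a \<otimes> x = x \<otimes> a}"
    interpret C: subgroup C G unfolding C_def by (rule subgroup_centralizer_element[OF a(1)])
    have "a \<in> C" "d \<in> C" unfolding C_def using a(1) d(1) ad by auto
    then have "y \<in> C"
      using that lee_weight_eq_iff[OF w d(1), of y] lee_weight_eq_iff[OF w, of "a \<otimes> d" y] wad a(1) d(1)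
      by (metis C.m_closed C.m_inv_closed m_closed)
    then show ?thesis unfolding C_def by simp
  qed
  define D where "D = {x \<in> carrier G. a \<otimes> x = x \<otimes> a}"
  have D: "subgroup D G" "d \<in> D" "b \<notin> D"
    unfolding D_def using subgroup_centralizer_element a(1) b(3) ad d(1) by auto
  \<comment> \<open>Since \<open>b\<close> does not commute with \<open>a\<close>, its products with
    \<open>d\<close> leave the centralizer of \<open>a\<close>. Only the weight
    \<open>w d + 2\<close> remains for them, so they are mutually inverse and \<open>d\<close> is an
    involution.\<close>
  have "b \<otimes> d \<notin> D" "d \<otimes> b \<notin> D" using in_subgroup_cancel[OF D(1,2) b(1)] D(3) by auto
  then have "w (b \<otimes> d) \<noteq> w d" "w (d \<otimes> b) \<noteq> w d" "w (b \<otimes> d) \<noteq> w d + 1" "w (d \<otimes> b) \<noteq> w d + 1"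
    using low b(1) d(1) unfolding D_def by auto
  then have "w (b \<otimes> d) = w (d \<otimes> b)"
    using weight_outside_bounds[OF w K(1) aK(2) d, unfolded wb] by linarith
  then have "d \<otimes> b = inv (b \<otimes> d)"
    using lee_weight_eq_iff[OF w, of "b \<otimes> d" "d \<otimes> b"] bd d(1) b(1) by auto
  then have "d \<otimes> b = inv d \<otimes> b" using invb d(1) b(1) by (simp add: inv_mult_group)
  then have "d = inv d" using d(1) b(1) by simp
  then show False using dd d(1) by (metis r_inv)
qed

section \<open>The correspondence between Lee metrics and Lee weights\<close>

text \<open>Right invariance identifies d(x y, y) with the weight of x, so passing from x y to the
  identity through y gives subadditivity.\<close>

lemma lee_metric_imp_lee_weight:
  assumes "lee_metric G d"
  shows "lee_weight G (\<lambda>x. nat \<lfloor>weight G d x\<rfloor>)"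
proof -
  let ?W = "weight G d" and ?w = "\<lambda>x. nat \<lfloor>weight G d x\<rfloor>"
  have m: "Metric_space (carrier G) d"
    and inv: "\<And>g g' h. g \<in> carrier G \<Longrightarrow> g' \<in> carrier G \<Longrightarrow> h \<in> carrier G \<Longrightarrow>
      d (g \<otimes> h) (g' \<otimes> h) = d g g'"
    and part: "metric_partition G d = lee_partition G"
    and im: "?W ` carrier G = real ` {0..card (metric_partition G d - {{\<one>}})}"
    using assms unfolding lee_metric_def interval_metric_def group_metric_def by auto
  interpret Metric_space "carrier G" d by (rule m)
  \<comment> \<open>The weights are natural numbers, so rounding loses nothing.\<close>
  have real_w: "real (?w x) = ?W x" if "x \<in> carrier G" for x
  proof -
    have "?W x \<in> real ` {0..card (metric_partition G d - {{\<one>}})}"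
      using that im by blast
    then show ?thesis by auto
  qed
  have sub: "?w (x \<otimes> y) \<le> ?w x + ?w y" if "x \<in> carrier G" "y \<in> carrier G" for x y
  proof -
    have "?W (x \<otimes> y) \<le> d (x \<otimes> y) y + d y \<one>"
      unfolding weight_def using that triangle by simp
    also have "d (x \<otimes> y) y = ?W x"
      unfolding weight_def using inv[of x \<one> y] that by simp
    finally have "?W (x \<otimes> y) \<le> ?W x + ?W y" by (simp add: weight_def)
    then show ?thesis
      using that real_w[of x] real_w[of y] real_w[of "x \<otimes> y"] by (simp flip: of_nat_add)
  qed
  have eq: "?w x = ?w y \<longleftrightarrow> y = x \<or> y = inv x" if x: "x \<in> carrier G" and y: "y \<in> carrier G" for x y
  proof -
    let ?R = "{(g, h). g \<in> carrier G \<and> h \<in> carrier G \<and> ?W g = ?W h}"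
    have "?R `` {x} \<in> lee_partition G"
      using x unfolding part[symmetric] metric_partition_def by (rule quotientI)
    then obtain a where a: "a \<in> carrier G" "?R `` {x} = {a, inv a}"
      unfolding lee_partition_def by blast
    have "x \<in> ?R `` {x}" using x by blast
    then have "x = a \<or> x = inv a" using a by blast
    then have "{a, inv a} = {x, inv x}" using a(1) by (metis inv_inv insert_commute)
    then have R: "?R `` {x} = {x, inv x}" using a(2) by simp
    have "?w x = ?w y \<longleftrightarrow> ?W x = ?W y"
      using real_w[OF x] real_w[OF y] by metis
    also have "\<dots> \<longleftrightarrow> y \<in> ?R `` {x}" using x y by simp
    also have "\<dots> \<longleftrightarrow> y = x \<or> y = inv x" unfolding R by simp
    finally show ?thesis .
  qed
  have "real ` ?w ` carrier G = real ` {0..card (metric_partition G d - {{\<one>}})}"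
    unfolding im[symmetric] image_image by (intro image_cong refl real_w)
  then have "?w ` carrier G = {0..card (metric_partition G d - {{\<one>}})}"
    by (rule inj_image_eq_iff[THEN iffD1, OF inj_of_nat])
  then show ?thesis by (rule lee_weightI[rotated 2]) (rule sub eq; assumption)+
qed

text \<open>The default value 0 outside the carrier keeps the function symmetric and nonnegative
  everywhere, as \<open>Metric_space\<close> demands.\<close>

lemma lee_weight_imp_lee_metric:
  assumes w: "lee_weight G w"
  shows "lee_metric G (\<lambda>g h. if g \<in> carrier G \<and> h \<in> carrier G then real (w (g \<otimes> inv h)) else 0)"
    (is "lee_metric G ?d")
proof -
  have W: "weight G ?d x = real (w x)" if "x \<in> carrier G" for x
    using that by (simp add: weight_def)
  have m: "Metric_space (carrier G) ?d"
  proof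
    fix x y z assume xyz: "x \<in> carrier G" "y \<in> carrier G" "z \<in> carrier G"
    have "w (x \<otimes> inv y \<otimes> (y \<otimes> inv z)) \<le> w (x \<otimes> inv y) + w (y \<otimes> inv z)"
      using xyz by (intro lee_weight_mult[OF w]) auto
    moreover have "x \<otimes> inv y \<otimes> (y \<otimes> inv z) = x \<otimes> inv z"
      using xyz by (simp add: m_assoc inv_mult_cancel)
    ultimately show "?d x z \<le> ?d x y + ?d y z" using xyz by simp
  next
    fix x y
    have "w (inv (x \<otimes> inv y)) = w (x \<otimes> inv y)" if "x \<in> carrier G" "y \<in> carrier G"
      using that by (intro lee_weight_inv[OF w]) auto
    then show "?d x y = ?d y x" by (auto simp: inv_mult_group)
  next
    fix x y assume xy: "x \<in> carrier G" "y \<in> carrier G"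
    then have "w (x \<otimes> inv y) = 0 \<longleftrightarrow> x = y"
      using lee_weight_eq_0_iff[OF w, of "x \<otimes> inv y"] inv_solve_right'[of \<one> x y] by simp
    then show "?d x y = 0 \<longleftrightarrow> x = y" using xy by simp
  qed auto
  have inv: "?d (g \<otimes> h) (g' \<otimes> h) = ?d g g'"
    if "g \<in> carrier G" "g' \<in> carrier G" "h \<in> carrier G" for g g' h
    using that by (simp add: inv_mult_group m_assoc inv_mult_cancel)
  have gm: "group_metric G ?d"
    unfolding group_metric_def using m inv by auto
  let ?R = "{(g, h). g \<in> carrier G \<and> h \<in> carrier G \<and> weight G ?d g = weight G ?d h}"
  have R: "?R `` {x} = {x, inv x}" if "x \<in> carrier G" for x
    using that lee_weight_eq_iff[OF w that] by (auto simp: W)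
  have part: "metric_partition G ?d = lee_partition G"
  proof -
    have "metric_partition G ?d = (\<Union>x\<in>carrier G. {{x, inv x}})"
      unfolding metric_partition_def quotient_def by (intro SUP_cong) (simp_all only: R)
    then show ?thesis unfolding lee_partition_def by blast
  qed
  obtain n where n: "w ` carrier G = {0..n}" using lee_weight_image[OF w] by blast
  \<comment> \<open>The parts are the fibres of \<open>w\<close>, one for each of the
    \<open>n + 1\<close> values; removing \<open>{\<one>}\<close> leaves \<open>n\<close>, the
    largest weight.\<close>
  have "metric_partition G ?d = (\<lambda>k. {x \<in> carrier G. w x = k}) ` {0..n}"
  proof -
    have "?R `` {x} = {y \<in> carrier G. w y = w x}" if "x \<in> carrier G" for x
      using that by (auto simp: W)
    then have "metric_partition G ?d = (\<Union>x\<in>carrier G. {{y \<in> carrier G. w y = w x}})"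
      unfolding metric_partition_def quotient_def by (intro SUP_cong) simp_all
    then show ?thesis unfolding n[symmetric] by blast
  qed
  moreover have "inj_on (\<lambda>k. {x \<in> carrier G. w x = k}) {0..n}"
  proof
    fix k l assume kl: "k \<in> {0..n}" "l \<in> {0..n}"
      "{x \<in> carrier G. w x = k} = {x \<in> carrier G. w x = l}"
    then have "k \<in> w ` carrier G" using n by simp
    then obtain x where "x \<in> carrier G" "w x = k" by (metis imageE)
    then show "k = l" using kl(3) by blast
  qed
  ultimately have "card (metric_partition G ?d) = n + 1"
    by (simp add: card_image)
  moreover have "{\<one>} \<in> metric_partition G ?d"
    unfolding part lee_partition_def by (auto intro!: exI[of _ \<one>])
  ultimately have "card (metric_partition G ?d - {{\<one>}}) = n"
    by (simp add: card_Diff_singleton)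
  moreover have "weight G ?d ` carrier G = real ` w ` carrier G"
    unfolding image_image by (intro image_cong) (auto simp: W)
  ultimately have "interval_metric G ?d"
    unfolding interval_metric_def using gm n by simp
  then show ?thesis unfolding lee_metric_def using part by blast
qed

lemma has_lee_metric_iff: "has_lee_metric G \<longleftrightarrow> (\<exists>w. lee_weight G w)"
  unfolding has_lee_metric_def
  using lee_metric_imp_lee_weight lee_weight_imp_lee_metric by blast

section \<open>Commutative groups of odd exponent and groups of exponent two\<close>

text \<open>Let \<open>d\<close> have minimal weight outside the powers of \<open>a\<close>. Both
  \<open>a\<close> and \<open>inv a\<close> have weight 1, and multiplying \<open>d\<close> by
  either gives weight \<open>w d + 1\<close>. So the two products are equal or mutually inverse, and
  \<open>a\<close> or \<open>d\<close> is an involution, contrary to the odd exponent.\<close>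

lemma lee_weight_generates_if_odd_commutative:
  assumes comm: "\<And>x y. x \<in> carrier G \<Longrightarrow> y \<in> carrier G \<Longrightarrow> x \<otimes> y = y \<otimes> x"
    and m: "odd m" "\<And>x. x \<in> carrier G \<Longrightarrow> x [^] (m::nat) = \<one>"
    and w: "lee_weight G w" and a: "a \<in> carrier G" "w a = 1"
  shows "range (\<lambda>n::int. a [^] n) = carrier G"
proof (rule ccontr)
  assume ne: "range (\<lambda>n::int. a [^] n) \<noteq> carrier G"
  let ?K = "range (\<lambda>n::int. a [^] n)"
  have K: "subgroup ?K G" by (rule subgroup_of_powers[OF a(1)])
  have aK: "a \<in> ?K" using int_pow_1[OF a(1)] by (metis rangeI)
  interpret K: subgroup ?K G by (rule K)
  have ane: "a \<noteq> \<one>" using a lee_weight_one[OF w] by auto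
  obtain k where k: "m + 1 = 2 * k" using m(1) by (metis even_Suc Suc_eq_plus1 evenE)
  \<comment> \<open>In odd exponent every element is a power of its square. This excludes
    involutions and keeps the square of \<open>d\<close> outside \<open>?K\<close>.\<close>
  have half: "x = (x \<otimes> x) [^] k" if "x \<in> carrier G" for x
  proof -
    have "(x \<otimes> x) [^] k = x [^] (m + 1)"
      unfolding k using that nat_pow_pow[of x 2 k] by (simp add: numeral_2_eq_2)
    also have "\<dots> = x" using that m(2)[OF that] by (simp add: nat_pow_mult)
    finally show ?thesis ..
  qed
  have half1: "x = \<one>" if "x \<in> carrier G" "x \<otimes> x = \<one>" for x
    using half[OF that(1)] that(2) by simp
  obtain d where d: "d \<in> carrier G" "d \<notin> ?K" "\<And>y. y \<in> carrier G \<Longrightarrow> y \<notin> ?K \<Longrightarrow> w d \<le> w y"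
    using minimal_weight_outside[OF K ne] by blast
  have dd: "d \<otimes> d \<notin> ?K"
  proof
    assume "d \<otimes> d \<in> ?K"
    then have "(d \<otimes> d) [^] int k \<in> ?K"
      by (rule subgroup_int_pow_closed[OF K])
    then show False using half[OF d(1)] d(2) by (simp add: int_pow_int)
  qed
  have step: "w (x \<otimes> d) = w d + 1" if x: "x \<in> ?K" "w x = 1" for x
  proof -
    have xG: "x \<in> carrier G" using x(1) K.mem_carrier by blast
    have "x \<otimes> d \<noteq> inv d"
    proof
      assume "x \<otimes> d = inv d"
      then have "x \<otimes> (d \<otimes> d) = \<one>" using xG d(1) by (metis l_inv m_assoc)
      then have "d \<otimes> d = inv x" using xG d(1) by (metis inv_equality inv_comm m_closed)
      then show False using dd x(1) K.m_inv_closed by metis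
    qed
    then show ?thesis using weight_one_times_minimal(1)[OF w x(2) K x(1) d] by blast
  qed
  have "w (a \<otimes> d) = w (inv a \<otimes> d)"
    using step[OF aK a(2)] step[of "inv a"] aK a lee_weight_inv[OF w a(1)] by simp
  then consider "inv a \<otimes> d = a \<otimes> d" | "inv a \<otimes> d = inv (a \<otimes> d)"
    using lee_weight_eq_iff[OF w, of "a \<otimes> d" "inv a \<otimes> d"] a(1) d(1) by auto
  then show False
  proof cases
    case 1
    then have "inv a = a" using a(1) d(1) by simp
    then have "a \<otimes> a = \<one>" using a(1) by (metis r_inv)
    then show False using half1 a ane by blast
  next
    case 2
    then have "inv a \<otimes> d = inv a \<otimes> inv d" using a(1) d(1) comm by (simp add: inv_mult_group)
    then have "d = inv d" using a(1) d(1) by simp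
    then have "d \<otimes> d = \<one>" using d(1) by (metis r_inv)
    then show False using dd by simp
  qed
qed

text \<open>The binary digits of the weight of \<open>x\<close> are the coordinates of \<open>x\<close> in a basis over the field
  with two elements; addition without carries is dominated by addition.\<close>

lemma lee_weight_if_exponent_two:
  assumes fin: "finite (carrier G)" and two: "\<And>x. x \<in> carrier G \<Longrightarrow> x \<otimes> x = \<one>"
  shows "\<exists>w. lee_weight G w"
proof -
  \<comment> \<open>The weight is built one generator at a time: a \<open>good\<close> subgroup
    carries a subadditive bijection onto an initial segment, and a maximal \<open>good\<close>
    subgroup is shown to be the whole group.\<close>
  define good where "good S \<longleftrightarrow> subgroup S G \<and>
    (\<exists>w n. bij_betw w S {0..<n::nat} \<and> (\<forall>x\<in>S. \<forall>y\<in>S. w (x \<otimes> y) \<le> w x + w y))" for S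
  have inv: "inv x = x" if "x \<in> carrier G" for x
    using that two by (simp add: inv_equality)
  have comm: "x \<otimes> y = y \<otimes> x" if "x \<in> carrier G" "y \<in> carrier G" for x y
    using inv[of "x \<otimes> y"] inv_mult_group[OF that] inv[OF that(1)] inv[OF that(2)] that by simp
  have "good {\<one>}"
    unfolding good_def by (intro conjI triv_subgroup exI[of _ "\<lambda>_. 0"] exI[of _ 1]) (auto simp: bij_betw_def)
  moreover have "finite {S. good S}"
  proof (rule finite_subset)
    show "{S. good S} \<subseteq> Pow (carrier G)" unfolding good_def using subgroup.subset by blast
  qed (use fin in simp)
  ultimately obtain S where S: "good S" and max: "\<And>T. good T \<Longrightarrow> S \<subseteq> T \<Longrightarrow> T = S"
    using finite_has_maximal[of "{S. good S}"] by auto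
  obtain w n where K: "subgroup S G" and w: "bij_betw w S {0..<n::nat}"
    and sub: "\<And>x y. x \<in> S \<Longrightarrow> y \<in> S \<Longrightarrow> w (x \<otimes> y) \<le> w x + w y"
    using S unfolding good_def by blast
  interpret S: subgroup S G by (rule K)
  have "S = carrier G"
  proof (rule ccontr)
    assume "S \<noteq> carrier G"
    then obtain g where g: "g \<in> carrier G" "g \<notin> S" using S.subset by blast
    define T where "T = S \<union> (\<otimes>) g ` S"
    \<comment> \<open>The offset \<open>n\<close>, the size of \<open>S\<close>, places the new
      coset directly above \<open>S\<close>; it is a new leading binary digit.\<close>
    define v where "v x = (if x \<in> S then w x else n + w (g \<otimes> x))" for x
    have gg: "g \<otimes> (g \<otimes> x) = x" if "x \<in> carrier G" for x
      using g(1) that two[OF g(1)] by (simp flip: m_assoc)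
    have gS: "g \<otimes> x \<notin> S" if "x \<in> S" for x
      using in_subgroup_cancel(2)[OF K that g(1)] g(2) by blast
    have g1: "x \<otimes> (g \<otimes> y) = g \<otimes> (x \<otimes> y)" if "x \<in> S" "y \<in> S" for x y
    proof -
      have "x \<in> carrier G" "y \<in> carrier G" using that by auto
      then show ?thesis using comm[of x g] g(1) by (simp flip: m_assoc)
    qed
    have g2: "(g \<otimes> x) \<otimes> (g \<otimes> y) = x \<otimes> y" if "x \<in> S" "y \<in> S" for x y
      using that g(1) g1[OF that] gg[of "x \<otimes> y"] by (simp add: m_assoc)
    have v: "v x = w x" "v (g \<otimes> x) = n + w x" if "x \<in> S" for x
      using that gS[OF that] gg[of x] by (auto simp: v_def)
    have wn: "w x < n" if "x \<in> S" for x
      using w that unfolding bij_betw_def by auto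
    have "subgroup T G"
    proof
      show "T \<subseteq> carrier G" unfolding T_def using g(1) by auto
      show "\<one> \<in> T" unfolding T_def by simp
      show "inv x \<in> T" if "x \<in> T" for x
        using that inv \<open>T \<subseteq> carrier G\<close> by auto
      fix x y assume "x \<in> T" "y \<in> T"
      then show "x \<otimes> y \<in> T"
        unfolding T_def by (auto simp: g1 gg m_assoc g(1))
    qed
    moreover have "bij_betw v T {0..<2 * n}"
    proof -
      have "bij_betw v S {0..<n}"
        using w v(1) by (metis bij_betw_cong)
      moreover have "bij_betw v ((\<otimes>) g ` S) {n..<2 * n}"
      proof -
        have "v ` (\<otimes>) g ` S = (\<lambda>k. n + k) ` w ` S" unfolding image_image using v(2) by (intro image_cong) auto
        also have "\<dots> = {n..<2 * n}" using w unfolding bij_betw_def by (simp add: mult_2)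
        finally have "v ` (\<otimes>) g ` S = {n..<2 * n}" .
        moreover have "inj_on v ((\<otimes>) g ` S)"
          using w v(2) unfolding bij_betw_def inj_on_def by auto
        ultimately show ?thesis unfolding bij_betw_def by blast
      qed
      ultimately have "bij_betw v (S \<union> (\<otimes>) g ` S) ({0..<n} \<union> {n..<2 * n})"
        by (rule bij_betw_combine) auto
      moreover have "{0..<n} \<union> {n..<2 * n} = {0..<2 * n}" by auto
      ultimately show ?thesis unfolding T_def by simp
    qed
    \<comment> \<open>Two elements of the coset multiply into \<open>S\<close>, so their offsets
      vanish from the left side only; a single offset appears on both sides.\<close>
    moreover have "v (x \<otimes> y) \<le> v x + v y" if "x \<in> T" "y \<in> T" for x y
    proof -
      have "v (x \<otimes> y) \<le> v x + v y" if "x \<in> S" "y \<in> S" for x y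
        using that sub v(1) by simp
      moreover have "v (x \<otimes> (g \<otimes> y)) \<le> v x + v (g \<otimes> y)" if "x \<in> S" "y \<in> S" for x y
        using that sub[OF that] by (simp add: g1 v)
      moreover have "v (g \<otimes> x \<otimes> y) \<le> v (g \<otimes> x) + v y" if "x \<in> S" "y \<in> S" for x y
        using that sub[OF that] g(1) by (simp add: m_assoc v)
      moreover have "v (g \<otimes> x \<otimes> (g \<otimes> y)) \<le> v (g \<otimes> x) + v (g \<otimes> y)" if "x \<in> S" "y \<in> S" for x y
        using that sub[OF that] by (simp add: g2 v)
      ultimately show ?thesis using that unfolding T_def by (elim UnE imageE) simp_all
    qed
    ultimately have "good T" unfolding good_def by blast
    then have "T = S" using max unfolding T_def by blast
    moreover have "g \<in> T" unfolding T_def using g(1) S.one_closed by (metis Un_iff imageI r_one)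
    ultimately show False using g(2) by blast
  qed
  then have bij: "bij_betw w (carrier G) {0..<n}" and
    sub': "\<And>x y. x \<in> carrier G \<Longrightarrow> y \<in> carrier G \<Longrightarrow> w (x \<otimes> y) \<le> w x + w y"
    using w sub by auto
  \<comment> \<open>The identity has a value below \<open>n\<close>, so the truncated subtraction in
    \<open>n - 1\<close> is harmless.\<close>
  have "n \<noteq> 0" using bij_betw_apply[OF bij one_closed] by auto
  then have "{0..<n} = {0..n - 1}" by auto
  then have "w ` carrier G = {0..n - 1}" using bij by (simp add: bij_betw_def)
  moreover have "w x = w y \<longleftrightarrow> y = x \<or> y = inv x" if "x \<in> carrier G" "y \<in> carrier G" for x y
    using inv[OF that(1)] bij that unfolding bij_betw_def inj_on_def by auto
  ultimately have "lee_weight G w" using sub' by (intro lee_weightI)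
  then show ?thesis by (rule exI[of _ w])
qed

text \<open>\<open>P g z\<close> says that an integer representative of \<open>g\<close> moves the origin of the real line to \<open>z\<close>,
  where the representatives act on the line by translations and point reflections; the weight of
  \<open>g\<close> is the distance by which \<open>g\<close> moves the origin of a quotient circle.\<close>

lemma lee_weight_if_displacements:
  fixes P :: "'a \<Rightarrow> int \<Rightarrow> bool" and N :: nat
  assumes mult: "\<And>g h y z. g \<in> carrier G \<Longrightarrow> h \<in> carrier G \<Longrightarrow> P g y \<Longrightarrow> P h z \<Longrightarrow>
      P (g \<otimes> h) (y + z) \<or> P (g \<otimes> h) (y - z)"
    and inv: "\<And>g z. g \<in> carrier G \<Longrightarrow> P g z \<Longrightarrow> P (inv g) z \<or> P (inv g) (- z)"
    and ex: "\<And>g. g \<in> carrier G \<Longrightarrow> \<exists>z. P g z \<and> \<bar>z\<bar> \<le> int N"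
    and unique: "\<And>g y z. g \<in> carrier G \<Longrightarrow> P g y \<Longrightarrow> P g z \<Longrightarrow> \<bar>y\<bar> \<le> int N \<Longrightarrow> \<bar>z\<bar> \<le> int N \<Longrightarrow> \<bar>y\<bar> = \<bar>z\<bar>"
    and determined: "\<And>g h y z. g \<in> carrier G \<Longrightarrow> h \<in> carrier G \<Longrightarrow> P g y \<Longrightarrow> P h z \<Longrightarrow> \<bar>y\<bar> = \<bar>z\<bar> \<Longrightarrow>
      h = g \<or> h = inv g"
    and onto: "\<And>k. k \<le> N \<Longrightarrow> \<exists>g\<in>carrier G. P g (int k) \<or> P g (- int k)"
  shows "\<exists>w. lee_weight G w"
proof -
  \<comment> \<open>Different representatives of \<open>g\<close> give different displacements on
    the line; the shortest one is the distance on the circle.\<close>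
  define w where "w g = (LEAST k. \<exists>z. P g z \<and> nat \<bar>z\<bar> = k)" for g
  have w_le: "w g \<le> nat \<bar>z\<bar>" if "P g z" for g z
    unfolding w_def using that by (intro Least_le) blast
  have w_ex: "\<exists>z. P g z \<and> nat \<bar>z\<bar> = w g" if "g \<in> carrier G" for g
    unfolding w_def using ex[OF that] by (intro LeastI_ex[of "\<lambda>k. \<exists>z. P g z \<and> nat \<bar>z\<bar> = k"]) blast
  have w_N: "w g \<le> N" if "g \<in> carrier G" for g
    using ex[OF that] w_le by fastforce
  \<comment> \<open>A shortest displacement also has length at most \<open>N\<close>, so by
    \<open>unique\<close> every displacement within that bound is a shortest one.\<close>
  have w_eq: "w g = nat \<bar>z\<bar>" if g: "g \<in> carrier G" "P g z" "\<bar>z\<bar> \<le> int N" for g z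
  proof -
    obtain y where y: "P g y" "nat \<bar>y\<bar> = w g" using w_ex[OF g(1)] by blast
    then show ?thesis using unique[OF g(1) y(1) g(2)] g(3) w_N[OF g(1)] by simp
  qed
  have "w (g \<otimes> h) \<le> w g + w h" if gh: "g \<in> carrier G" "h \<in> carrier G" for g h
  proof -
    obtain y z where "P g y" "nat \<bar>y\<bar> = w g" "P h z" "nat \<bar>z\<bar> = w h" using w_ex gh by meson
    then show ?thesis using mult[OF gh] w_le[of "g \<otimes> h" "y + z"] w_le[of "g \<otimes> h" "y - z"] by force
  qed
  moreover have "w g = w h \<longleftrightarrow> h = g \<or> h = inv g" if gh: "g \<in> carrier G" "h \<in> carrier G" for g h
  proof
    obtain y z where y: "P g y" "nat \<bar>y\<bar> = w g" and z: "P h z" "nat \<bar>z\<bar> = w h" using w_ex gh by meson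
    show "h = g \<or> h = inv g" if "w g = w h"
      using determined[OF gh y(1) z(1)] y(2) z(2) that by simp
    have "w (inv g) = nat \<bar>y\<bar>"
      using inv[OF gh(1) y(1)] w_eq[of "inv g" y] w_eq[of "inv g" "- y"] y(2) w_N[OF gh(1)] gh(1) by auto
    then show "w g = w h" if "h = g \<or> h = inv g" using that y(2) by auto
  qed
  moreover have "w ` carrier G = {0..N}"
  proof
    show "w ` carrier G \<subseteq> {0..N}" using w_N by auto
    show "{0..N} \<subseteq> w ` carrier G"
    proof
      fix k assume "k \<in> {0..N}"
      then have k: "k \<le> N" by simp
      then obtain g where "g \<in> carrier G" "P g (int k) \<or> P g (- int k)" using onto by blast
      then have "w g = k" using w_eq[of g "int k"] w_eq[of g "- int k"] k by auto
      then show "k \<in> w ` carrier G" using \<open>g \<in> carrier G\<close> by blast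
    qed
  qed
  ultimately have "lee_weight G w" by (intro lee_weightI)
  then show ?thesis by (rule exI[of _ w])
qed

end

section \<open>Finite fields\<close>

text \<open>Powers of \<open>x\<close> agree exactly when their exponents agree modulo
  \<open>n\<close>, so exponentiation is an isomorphism from the residues onto the group.\<close>

lemma (in group) iso_integer_mod_group:
  assumes x: "x \<in> carrier G" and gen: "carrier G = range (\<lambda>i::int. x [^] i)" and n: "ord x = n" "n > 0"
  shows "G \<cong> integer_mod_group n"
proof -
  have eq: "x [^] i = x [^] j \<longleftrightarrow> int n dvd j - i" for i j :: int
    using int_pow_eq[OF x, of i j] n by simp
  let ?f = "\<lambda>i::int. x [^] i"
  have "?f \<in> iso (integer_mod_group n) G"
  proof (rule isoI)
    show "?f \<in> hom (integer_mod_group n) G"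
    proof (rule homI)
      fix i j :: int
      have "x [^] ((i + j) mod int n) = x [^] (i + j)"
        unfolding eq by (simp add: minus_mod_eq_mult_div)
      then show "x [^] (i \<otimes>\<^bsub>integer_mod_group n\<^esub> j) = x [^] i \<otimes> x [^] j"
        using x by (simp add: int_pow_mult)
    qed (use x in simp)
    show "bij_betw ?f (carrier (integer_mod_group n)) (carrier G)"
      unfolding bij_betw_def
    proof
      show "inj_on ?f (carrier (integer_mod_group n))"
      proof
        fix i j assume ij: "i \<in> carrier (integer_mod_group n)" "j \<in> carrier (integer_mod_group n)"
          "x [^] i = x [^] j"
        then have "j mod int n = i mod int n" unfolding eq by (simp add: mod_eq_dvd_iff)
        then show "i = j" using ij n(2) by (simp add: carrier_integer_mod_group)
      qed
      show "?f ` carrier (integer_mod_group n) = carrier G"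
      proof
        show "carrier G \<subseteq> ?f ` carrier (integer_mod_group n)"
        proof
          fix y assume "y \<in> carrier G"
          then obtain i where y: "y = x [^] (i::int)" using gen by blast
          also have "\<dots> = x [^] (i mod int n)"
            unfolding eq by (simp add: mod_eq_dvd_iff[symmetric])
          finally show "y \<in> ?f ` carrier (integer_mod_group n)"
            using n(2) by (auto simp: carrier_integer_mod_group)
        qed
      qed (use x in auto)
    qed
  qed
  then show ?thesis
    using group.iso_sym[OF group_integer_mod_group, of n G] is_isoI by blast
qed

lemma (in field) minus_one_square: "\<ominus> \<one> \<otimes> \<ominus> \<one> = \<one>"
  by algebra

lemma (in field) square_eq_one_imp:
  assumes "x \<in> carrier R" "x \<otimes> x = \<one>"
  shows "x = \<one> \<or> x = \<ominus> \<one>"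
proof -
  have "(x \<ominus> \<one>) \<otimes> (x \<oplus> \<one>) = x \<otimes> x \<ominus> \<one>" using assms(1) by algebra
  then have "(x \<ominus> \<one>) \<otimes> (x \<oplus> \<one>) = \<zero>" using assms by simp
  then have "x \<ominus> \<one> = \<zero> \<or> x \<oplus> \<one> = \<zero>" using assms(1) by (simp add: integral_iff)
  then show ?thesis
    using assms(1) minus_equality[of x \<one>] by (auto simp: a_comm)
qed

text \<open>The multiple p^k of 1 vanishes by the order of the additive group and equals the k-th
  power of the multiple p of 1; a field has no nonzero nilpotents.\<close>

lemma (in field) add_pow_prime_eq_zero:
  assumes "card (carrier R) = p ^ k" "finite (carrier R)" "b \<in> carrier R"
  shows "[p] \<cdot> b = \<zero>"
proof -
  have "[card (carrier R)] \<cdot> \<one> = \<zero>"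
    using add.pow_order_eq_1[OF one_closed] unfolding order_def by simp
  moreover have "[(p ^ k)] \<cdot> \<one> = ([p] \<cdot> \<one>) [^] k"
  proof (induction k)
    case (Suc k)
    have "[(p ^ Suc k)] \<cdot> \<one> = [(p ^ k)] \<cdot> ([p] \<cdot> \<one>)"
      using add.nat_pow_pow[of \<one> "p ^ k" p] by simp
    also have "\<dots> = [(p ^ k)] \<cdot> \<one> \<otimes> [p] \<cdot> \<one>"
      using add_pow_ldistr[of \<one> "[p] \<cdot> \<one>" "p ^ k"] by simp
    finally show ?case using Suc by simp
  qed simp
  ultimately have "([p] \<cdot> \<one>) [^] k = \<zero>" using assms(1) by simp
  then have "[p] \<cdot> \<one> = \<zero>"
    by (induction k) (auto simp: integral_iff)
  then show ?thesis
    using add_pow_ldistr[of \<one> b p] assms(3) by simp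
qed

lemma abs_congruent_eq:
  fixes y z m :: int
  assumes "m dvd y - z" "2 * \<bar>y\<bar> < m" "2 * \<bar>z\<bar> < m"
  shows "y = z"
proof -
  have "\<bar>y - z\<bar> < m" using assms(2,3) by linarith
  then show ?thesis using assms(1) zdvd_imp_le[of m "\<bar>y - z\<bar>"] by fastforce
qed

section \<open>Affine groups over finite fields\<close>

locale affine_field = field F for F :: "('a, 'm) ring_scheme" (structure) +
  fixes H :: "'a set"
  assumes fin: "finite (carrier F)" and H: "subgroup H (mult_of F)"
begin

section \<open>Matrix arithmetic and commutation\<close>

abbreviation aff :: "'a \<Rightarrow> 'a \<Rightarrow> 'a mat2" where
  "aff a b \<equiv> ((a, b), (\<zero>, \<one>))"

sublocale A: group "affine_subgroup F H"
  by (rule group_affine_subgroup[OF field_axioms H])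

lemma H_carrier: "a \<in> H \<Longrightarrow> a \<in> carrier F" "a \<in> H \<Longrightarrow> a \<noteq> \<zero>"
  using subgroup.subset[OF H] by auto

lemma one_minus_one: "\<one> \<ominus> \<one> = \<zero>"
  by (simp add: minus_eq r_neg)

lemma one_in_H: "\<one> \<in> H"
  using subgroup.one_closed[OF H] by simp

lemma mult_in_H: "a \<in> H \<Longrightarrow> b \<in> H \<Longrightarrow> a \<otimes> b \<in> H"
  using subgroup.m_closed[OF H] by simp

lemma carrier_A: "carrier (affine_subgroup F H) = {aff a b | a b. a \<in> H \<and> b \<in> carrier F}"
  by (simp add: affine_subgroup_def)

lemma aff_in_A: "aff a b \<in> carrier (affine_subgroup F H) \<longleftrightarrow> a \<in> H \<and> b \<in> carrier F"
  by (auto simp: carrier_A)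

lemma A_cases:
  assumes "x \<in> carrier (affine_subgroup F H)"
  obtains a b where "x = aff a b" "a \<in> H" "b \<in> carrier F" "a \<in> carrier F" "a \<noteq> \<zero>"
  using assms H_carrier unfolding carrier_A by blast

lemma one_A: "\<one>\<^bsub>affine_subgroup F H\<^esub> = aff \<one> \<zero>"
  by (simp add: affine_subgroup_def)

lemma aff_mult:
  assumes "a \<in> carrier F" "b \<in> carrier F" "c \<in> carrier F" "d \<in> carrier F"
  shows "aff a b \<otimes>\<^bsub>affine_subgroup F H\<^esub> aff c d = aff (a \<otimes> c) (a \<otimes> d \<oplus> b)"
  using assms by (simp add: affine_subgroup_def)

text \<open>The two products differ at most in the upper right entry. The criterion is the vanishing
  of the determinant of (a - 1, b) and (c - 1, d).\<close>

lemma aff_commute_iff: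
  assumes "a \<in> carrier F" "b \<in> carrier F" "c \<in> carrier F" "d \<in> carrier F"
  shows "aff a b \<otimes>\<^bsub>affine_subgroup F H\<^esub> aff c d = aff c d \<otimes>\<^bsub>affine_subgroup F H\<^esub> aff a b
    \<longleftrightarrow> (a \<ominus> \<one>) \<otimes> d = (c \<ominus> \<one>) \<otimes> b"
proof -
  have "a \<otimes> d \<oplus> b = (a \<ominus> \<one>) \<otimes> d \<oplus> (b \<oplus> d)" "c \<otimes> b \<oplus> d = (c \<ominus> \<one>) \<otimes> b \<oplus> (b \<oplus> d)"
    using assms by algebra+
  then have "a \<otimes> d \<oplus> b = c \<otimes> b \<oplus> d \<longleftrightarrow> (a \<ominus> \<one>) \<otimes> d = (c \<ominus> \<one>) \<otimes> b"
    using assms by simp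
  then show ?thesis using assms by (simp add: aff_mult m_comm)
qed

text \<open>Commuting means linear dependence of the vectors (a - 1, b), which is transitive through
  a nonzero vector; the vector of \<open>x\<close> is zero only for the identity.\<close>

lemma commutation_transitive_A: "commutation_transitive (affine_subgroup F H)"
  unfolding commutation_transitive_def
proof (intro ballI impI)
  let ?A = "affine_subgroup F H"
  fix x y z assume x: "x \<in> carrier ?A - {\<one>\<^bsub>?A\<^esub>}" and y: "y \<in> carrier ?A" and z: "z \<in> carrier ?A"
    and xy: "x \<otimes>\<^bsub>?A\<^esub> y = y \<otimes>\<^bsub>?A\<^esub> x" and xz: "x \<otimes>\<^bsub>?A\<^esub> z = z \<otimes>\<^bsub>?A\<^esub> x"
  obtain a b where ab: "x = aff a b" "a \<in> carrier F" "b \<in> carrier F"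
    using x by (blast elim: A_cases)
  obtain c d where cd: "y = aff c d" "c \<in> carrier F" "d \<in> carrier F"
    using y by (blast elim: A_cases)
  obtain e f where ef: "z = aff e f" "e \<in> carrier F" "f \<in> carrier F"
    using z by (blast elim: A_cases)
  have 1: "(a \<ominus> \<one>) \<otimes> d = (c \<ominus> \<one>) \<otimes> b" "(a \<ominus> \<one>) \<otimes> f = (e \<ominus> \<one>) \<otimes> b"
    using xy xz ab cd ef by (simp_all add: aff_commute_iff)
  have "(c \<ominus> \<one>) \<otimes> f = (e \<ominus> \<one>) \<otimes> d"
  \<comment> \<open>If \<open>a = \<one>\<close>, then \<open>b\<close> is nonzero and all three
    matrices are translations. Otherwise the factor \<open>a \<ominus> \<one>\<close> can be
    cancelled.\<close>
  proof (cases "a = \<one>")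
    case True
    then have "b \<noteq> \<zero>" using x ab by (auto simp: one_A)
    moreover have "(c \<ominus> \<one>) \<otimes> b = \<zero>" "(e \<ominus> \<one>) \<otimes> b = \<zero>"
      using 1[symmetric] True cd(3) ef(3) by (simp_all add: one_minus_one)
    ultimately have "c \<ominus> \<one> = \<zero>" "e \<ominus> \<one> = \<zero>"
      using ab cd ef by (metis integral minus_closed one_closed)+
    then show ?thesis using cd ef by (simp add: one_minus_one)
  next
    case False
    then have ne: "a \<ominus> \<one> \<noteq> \<zero>" using ab by simp
    have "(a \<ominus> \<one>) \<otimes> ((c \<ominus> \<one>) \<otimes> f) = (c \<ominus> \<one>) \<otimes> ((a \<ominus> \<one>) \<otimes> f)"
      using ab cd ef by algebra
    also have "\<dots> = (e \<ominus> \<one>) \<otimes> ((c \<ominus> \<one>) \<otimes> b)"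
      unfolding 1 using ab cd ef by algebra
    also have "\<dots> = (a \<ominus> \<one>) \<otimes> ((e \<ominus> \<one>) \<otimes> d)"
      unfolding 1[symmetric] using ab cd ef by algebra
    finally show ?thesis using ne ab cd ef by (simp add: m_lcancel)
  qed
  then show "y \<otimes>\<^bsub>?A\<^esub> z = z \<otimes>\<^bsub>?A\<^esub> y" using cd ef by (simp add: aff_commute_iff)
qed

lemma noncommuting_A:
  assumes "H \<noteq> {\<one>}"
  obtains g h where "g \<in> carrier (affine_subgroup F H)" "h \<in> carrier (affine_subgroup F H)"
    "g \<otimes>\<^bsub>affine_subgroup F H\<^esub> h \<noteq> h \<otimes>\<^bsub>affine_subgroup F H\<^esub> g"
proof -
  obtain a where a: "a \<in> H" "a \<noteq> \<one>" using assms one_in_H by blast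
  show thesis
  proof (rule that)
    show "aff a \<zero> \<in> carrier (affine_subgroup F H)" "aff \<one> \<one> \<in> carrier (affine_subgroup F H)"
      using a one_in_H by (auto simp: aff_in_A)
    show "aff a \<zero> \<otimes>\<^bsub>affine_subgroup F H\<^esub> aff \<one> \<one> \<noteq> aff \<one> \<one> \<otimes>\<^bsub>affine_subgroup F H\<^esub> aff a \<zero>"
      using a H_carrier[OF a(1)] by (simp add: aff_commute_iff r_right_minus_eq)
  qed
qed

lemma aff_square_eq_one_iff:
  assumes "a \<in> carrier F" "b \<in> carrier F"
  shows "aff a b \<otimes>\<^bsub>affine_subgroup F H\<^esub> aff a b = \<one>\<^bsub>affine_subgroup F H\<^esub>
    \<longleftrightarrow> a \<otimes> a = \<one> \<and> (a \<oplus> \<one>) \<otimes> b = \<zero>"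
  using assms by (simp add: aff_mult one_A l_distr)

section \<open>Nonexistence for nontrivial \<open>H\<close>\<close>

text \<open>A Lee weight would provide noncommuting involutions, but in characteristic two an
  involution has upper left entry 1, and translations commute.\<close>

lemma no_lee_metric_char_two:
  assumes two: "\<one> \<oplus> \<one> = \<zero>" and nt: "H \<noteq> {\<one>}"
  shows "\<not> has_lee_metric (affine_subgroup F H)"
proof
  assume "has_lee_metric (affine_subgroup F H)"
  then obtain w where w: "lee_weight (affine_subgroup F H) w"
    unfolding A.has_lee_metric_iff by blast
  obtain g h where g: "g \<in> carrier (affine_subgroup F H)" "h \<in> carrier (affine_subgroup F H)"
    "g \<otimes>\<^bsub>affine_subgroup F H\<^esub> h \<noteq> h \<otimes>\<^bsub>affine_subgroup F H\<^esub> g"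
    using noncommuting_A[OF nt] by blast
  obtain x y where x: "x \<in> carrier (affine_subgroup F H)"
      "x \<otimes>\<^bsub>affine_subgroup F H\<^esub> x = \<one>\<^bsub>affine_subgroup F H\<^esub>"
    and y: "y \<in> carrier (affine_subgroup F H)"
      "y \<otimes>\<^bsub>affine_subgroup F H\<^esub> y = \<one>\<^bsub>affine_subgroup F H\<^esub>"
    and nc: "x \<otimes>\<^bsub>affine_subgroup F H\<^esub> y \<noteq> y \<otimes>\<^bsub>affine_subgroup F H\<^esub> x"
    by (rule A.lee_weight_noncommuting_involutions[OF w commutation_transitive_A g]) (rule that; assumption)
  obtain a b where ab: "x = aff a b" "a \<in> carrier F" "b \<in> carrier F"
    using x(1) by (blast elim: A_cases)
  obtain c d where cd: "y = aff c d" "c \<in> carrier F" "d \<in> carrier F"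
    using y(1) by (blast elim: A_cases)
  have "\<ominus> \<one> = \<one>" using two by (simp add: minus_equality)
  moreover have "a \<otimes> a = \<one>" "c \<otimes> c = \<one>"
    using x(2) y(2) ab(2,3) cd(2,3) unfolding ab(1) cd(1) by (simp_all add: aff_square_eq_one_iff)
  ultimately have "a = \<one>" "c = \<one>"
    using square_eq_one_imp[OF ab(2)] square_eq_one_imp[OF cd(2)] by simp_all
  then show False using nc ab cd by (simp add: aff_commute_iff one_minus_one)
qed

text \<open>The subgroup \<open>K\<close> of matrices whose upper left entry is a fourth root of
  unity contains all elements of order dividing 4, and \<open>a\<close> shows that it is proper. In
  odd characteristic the involutions have upper left entry -1, and two of them commute only if they
  are equal.\<close>

lemma no_lee_metric_char_odd:
  assumes two: "\<one> \<oplus> \<one> \<noteq> \<zero>" and a: "a \<in> H" "(a \<otimes> a) \<otimes> (a \<otimes> a) \<noteq> \<one>"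
  shows "\<not> has_lee_metric (affine_subgroup F H)"
proof -
  let ?A = "affine_subgroup F H"
  define K where "K = {aff a b | a b. a \<in> H \<and> b \<in> carrier F \<and> (a \<otimes> a) \<otimes> (a \<otimes> a) = \<one>}"
  have aF: "a \<in> carrier F" using H_carrier a by blast
  have subK: "K \<subseteq> carrier ?A" unfolding K_def carrier_A by blast
  have subgroup_K: "subgroup K ?A"
  proof
    show "K \<subseteq> carrier ?A" by (rule subK)
    show "\<one>\<^bsub>?A\<^esub> \<in> K" unfolding K_def using one_in_H by (auto simp: one_A)
  next
    fix x y assume x: "x \<in> K" and y: "y \<in> K"
    obtain a b where ab: "x = aff a b" "a \<in> H" "b \<in> carrier F" "(a \<otimes> a) \<otimes> (a \<otimes> a) = \<one>"
      using x unfolding K_def by blast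
    obtain c d where cd: "y = aff c d" "c \<in> H" "d \<in> carrier F" "(c \<otimes> c) \<otimes> (c \<otimes> c) = \<one>"
      using y unfolding K_def by blast
    have F: "a \<in> carrier F" "c \<in> carrier F" using ab cd H_carrier by blast+
    then have "((a \<otimes> c) \<otimes> (a \<otimes> c)) \<otimes> ((a \<otimes> c) \<otimes> (a \<otimes> c)) = ((a \<otimes> a) \<otimes> (a \<otimes> a)) \<otimes> ((c \<otimes> c) \<otimes> (c \<otimes> c))"
      by algebra
    then have "((a \<otimes> c) \<otimes> (a \<otimes> c)) \<otimes> ((a \<otimes> c) \<otimes> (a \<otimes> c)) = \<one>"
      unfolding ab(4) cd(4) by simp
    moreover have "x \<otimes>\<^bsub>?A\<^esub> y = aff (a \<otimes> c) (a \<otimes> d \<oplus> b)"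
      unfolding ab(1) cd(1) using F ab cd by (intro aff_mult)
    moreover have "a \<otimes> d \<oplus> b \<in> carrier F" using F ab cd by simp
    ultimately show "x \<otimes>\<^bsub>?A\<^esub> y \<in> K" unfolding K_def using mult_in_H[OF ab(2) cd(2)] by blast
  next
    fix x assume x: "x \<in> K"
    obtain a b where ab: "x = aff a b" "a \<in> H" "b \<in> carrier F" "(a \<otimes> a) \<otimes> (a \<otimes> a) = \<one>"
      using x unfolding K_def by blast
    have xA: "x \<in> carrier ?A" using x subK by blast
    obtain c d where cd: "inv\<^bsub>?A\<^esub> x = aff c d" "c \<in> H" "d \<in> carrier F"
      using A_cases[OF A.inv_closed[OF xA]] by blast
    have F: "a \<in> carrier F" "c \<in> carrier F" using ab cd H_carrier by blast+
    have "aff c d \<otimes>\<^bsub>?A\<^esub> aff a b = \<one>\<^bsub>?A\<^esub>" using A.l_inv[OF xA] unfolding cd(1) unfolding ab(1) .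
    then have ca: "c \<otimes> a = \<one>" using F ab(3) cd(3) by (simp add: aff_mult one_A)
    have "(c \<otimes> c) \<otimes> (c \<otimes> c) \<otimes> ((a \<otimes> a) \<otimes> (a \<otimes> a)) = ((c \<otimes> a) \<otimes> (c \<otimes> a)) \<otimes> ((c \<otimes> a) \<otimes> (c \<otimes> a))"
      using F by algebra
    then have "(c \<otimes> c) \<otimes> (c \<otimes> c) = \<one>" unfolding ab(4) ca using F by simp
    then show "inv\<^bsub>?A\<^esub> x \<in> K" unfolding K_def using cd by blast
  qed
  have "aff a \<zero> \<in> carrier ?A" "aff a \<zero> \<notin> K" using a unfolding K_def by (auto simp: aff_in_A)
  then have K_ne: "K \<noteq> carrier ?A" by blast
  have quartic: "x \<in> K" if x: "x \<in> carrier ?A"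
    "(x \<otimes>\<^bsub>?A\<^esub> x) \<otimes>\<^bsub>?A\<^esub> (x \<otimes>\<^bsub>?A\<^esub> x) = \<one>\<^bsub>?A\<^esub>" for x
  proof -
    obtain a b where ab: "x = aff a b" "a \<in> carrier F" "b \<in> carrier F"
      using x(1) by (blast elim: A_cases)
    then have "(a \<otimes> a) \<otimes> (a \<otimes> a) = \<one>" using x(2) by (simp add: aff_mult one_A)
    moreover have "a \<in> H" using x(1) unfolding ab(1) aff_in_A by blast
    ultimately show ?thesis unfolding K_def using ab by blast
  qed
  have invol: "x = y" if x: "x \<in> carrier ?A" and y: "y \<in> carrier ?A"
    and x1: "x \<noteq> \<one>\<^bsub>?A\<^esub>" and y1: "y \<noteq> \<one>\<^bsub>?A\<^esub>"
    and xx: "x \<otimes>\<^bsub>?A\<^esub> x = \<one>\<^bsub>?A\<^esub>" and yy: "y \<otimes>\<^bsub>?A\<^esub> y = \<one>\<^bsub>?A\<^esub>"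
    and xy: "x \<otimes>\<^bsub>?A\<^esub> y = y \<otimes>\<^bsub>?A\<^esub> x" for x y
  proof -
    have inv: "a = \<ominus> \<one>" if "aff a b \<noteq> \<one>\<^bsub>?A\<^esub>" "a \<in> carrier F" "b \<in> carrier F"
      "aff a b \<otimes>\<^bsub>?A\<^esub> aff a b = \<one>\<^bsub>?A\<^esub>" for a b
    proof -
      have s: "a \<otimes> a = \<one>" "(a \<oplus> \<one>) \<otimes> b = \<zero>" using that by (auto simp: aff_square_eq_one_iff)
      then have "a = \<one> \<or> a = \<ominus> \<one>" using square_eq_one_imp that by blast
      moreover have "a \<noteq> \<one>"
      proof
        assume "a = \<one>"
        then have "b = \<zero>" using s(2) two that(3) by (metis add.m_closed integral one_closed)
        then show False using \<open>a = \<one>\<close> that(1) by (simp add: one_A)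
      qed
      ultimately show ?thesis by blast
    qed
    obtain a b where ab: "x = aff a b" "a \<in> carrier F" "b \<in> carrier F"
      using x by (blast elim: A_cases)
    obtain c d where cd: "y = aff c d" "c \<in> carrier F" "d \<in> carrier F"
      using y by (blast elim: A_cases)
    have a: "a = \<ominus> \<one>" "c = \<ominus> \<one>"
      using inv[OF x1[unfolded ab(1)] ab(2,3) xx[unfolded ab(1)]]
        inv[OF y1[unfolded cd(1)] cd(2,3) yy[unfolded cd(1)]] by blast+
    have "(\<ominus> \<one> \<ominus> \<one>) \<otimes> d = (\<ominus> \<one> \<ominus> \<one>) \<otimes> b"
      using xy ab cd a by (simp add: aff_commute_iff)
    moreover have "\<ominus> \<one> \<ominus> \<one> \<noteq> \<zero>"
    proof
      assume "\<ominus> \<one> \<ominus> \<one> = \<zero>"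
      moreover have "\<one> \<oplus> \<one> = \<ominus> (\<ominus> \<one> \<ominus> \<one>)" by algebra
      ultimately show False using two by simp
    qed
    ultimately have "d = b" using ab cd by (simp add: m_lcancel)
    then show ?thesis using ab cd a by simp
  qed
  have "H \<noteq> {\<one>}" using a by auto
  then obtain g h where gh: "g \<in> carrier ?A" "h \<in> carrier ?A" "g \<otimes>\<^bsub>?A\<^esub> h \<noteq> h \<otimes>\<^bsub>?A\<^esub> g"
    using noncommuting_A by blast
  have "\<not> lee_weight ?A w" for w
    by (rule A.not_lee_weight_if_commutation_transitive
        [OF commutation_transitive_A invol subgroup_K K_ne quartic gh])
  then show ?thesis unfolding A.has_lee_metric_iff by blast
qed

section \<open>Small subgroups of the multiplicative group\<close>

text \<open>Squares of elements of \<open>H\<close> are 1 or -1. If some \<open>a\<close> squares to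
  -1, then \<open>H\<close> consists of 1, -1, a, -a and is generated by \<open>a\<close>; otherwise
  it lies in {1, -1}.\<close>

lemma fourth_roots_of_unity_cases:
  assumes two: "\<one> \<oplus> \<one> \<noteq> \<zero>" and roots: "\<And>a. a \<in> H \<Longrightarrow> (a \<otimes> a) \<otimes> (a \<otimes> a) = \<one>"
  shows "H = {\<one>} \<or> (mult_of F)\<lparr>carrier := H\<rparr> \<cong> integer_mod_group 2 \<or>
    (mult_of F)\<lparr>carrier := H\<rparr> \<cong> integer_mod_group 4"
proof -
  let ?M = "(mult_of F)\<lparr>carrier := H\<rparr>"
  interpret M: group ?M
    using group.subgroup_imp_group[OF field_mult_group H] .
  have pow: "x [^]\<^bsub>?M\<^esub> n = x [^] n" for x and n :: nat
    by (induction n) (simp_all add: nat_pow_def)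
  have m1: "\<ominus> \<one> \<noteq> \<one>" using two r_neg[OF one_closed] by metis
  have sq: "a \<otimes> a = \<one> \<or> a \<otimes> a = \<ominus> \<one>" if "a \<in> H" for a
    using square_eq_one_imp[of "a \<otimes> a"] roots[OF that] H_carrier[OF that] by simp
  show ?thesis
  proof (cases "\<exists>a\<in>H. a \<otimes> a = \<ominus> \<one>")
    case True
    then obtain a where a: "a \<in> H" "a \<otimes> a = \<ominus> \<one>" by blast
    have aF: "a \<in> carrier F" using H_carrier a by blast
    have p2: "a [^]\<^bsub>?M\<^esub> (2::nat) = \<ominus> \<one>" using a aF by (simp add: pow numeral_2_eq_2)
    have "a [^]\<^bsub>?M\<^esub> (4::nat) = a [^]\<^bsub>?M\<^esub> (2::nat) \<otimes>\<^bsub>?M\<^esub> a [^]\<^bsub>?M\<^esub> (2::nat)"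
      using M.nat_pow_mult[of a 2 2] a(1) by simp
    then have p4: "a [^]\<^bsub>?M\<^esub> (4::nat) = \<one>" unfolding p2 using minus_one_square by simp
    have ord: "M.ord a = 4"
    proof -
      \<comment> \<open>A divisor of 4 that does not divide 2 is 4 itself.\<close>
      have "M.ord a dvd 2 ^ 2" using M.pow_eq_id[of a 4] a(1) p4 by simp
      then obtain i where i: "i \<le> 2" "M.ord a = 2 ^ i"
        using divides_primepow_nat[of 2 "M.ord a" 2] by auto
      moreover have "\<not> M.ord a dvd 2" using M.pow_eq_id[of a 2] a(1) p2 m1 by simp
      ultimately show ?thesis
        by (metis One_nat_def dvd_refl le_Suc_eq le_zero_eq numeral_2_eq_2 one_dvd power_0 power_one_right
            power2_eq_square num_double numeral_times_numeral)
    qed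
    have "H = range (\<lambda>i::int. a [^]\<^bsub>?M\<^esub> i)"
    proof
      show "range (\<lambda>i::int. a [^]\<^bsub>?M\<^esub> i) \<subseteq> H"
        using M.int_pow_closed[of a] a(1) by auto
      show "H \<subseteq> range (\<lambda>i::int. a [^]\<^bsub>?M\<^esub> i)"
      proof
        fix x assume x: "x \<in> H"
        have xF: "x \<in> carrier F" using H_carrier x by blast
        have "x \<in> {\<one>, \<ominus> \<one>, a, \<ominus> \<one> \<otimes> a}"
        proof (cases "x \<otimes> x = \<one>")
          case True
          then show ?thesis using square_eq_one_imp xF by blast
        next
          case False
          then have "x \<otimes> x = \<ominus> \<one>" using sq x by blast
          then have "(x \<ominus> a) \<otimes> (x \<oplus> a) = \<zero>"
          proof -
            have "(x \<ominus> a) \<otimes> (x \<oplus> a) = x \<otimes> x \<ominus> a \<otimes> a" using xF aF by algebra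
            then show ?thesis using \<open>x \<otimes> x = \<ominus> \<one>\<close> a(2) by (simp add: r_right_minus_eq)
          qed
          then have "x \<ominus> a = \<zero> \<or> x \<oplus> a = \<zero>" using xF aF by (simp add: integral_iff)
          then show ?thesis using xF aF minus_equality[of x a] by (auto simp: l_minus)
        qed
        moreover have "\<one> = a [^]\<^bsub>?M\<^esub> (int 0)" "\<ominus> \<one> = a [^]\<^bsub>?M\<^esub> (int 2)"
          "a = a [^]\<^bsub>?M\<^esub> (int 1)" "\<ominus> \<one> \<otimes> a = a [^]\<^bsub>?M\<^esub> (int 3)"
          using p2 a(1) M.nat_pow_Suc[of a 2] by (simp_all only: int_pow_int) (simp_all add: pow aF numeral_3_eq_3 numeral_2_eq_2)
        ultimately show "x \<in> range (\<lambda>i::int. a [^]\<^bsub>?M\<^esub> i)" by blast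
      qed
    qed
    then have "?M \<cong> integer_mod_group 4"
      using M.iso_integer_mod_group[of a 4] a(1) ord by simp
    then show ?thesis by blast
  next
    case False
    then have pm: "a = \<one> \<or> a = \<ominus> \<one>" if "a \<in> H" for a
      using that sq square_eq_one_imp H_carrier by blast
    show ?thesis
    proof (cases "\<ominus> \<one> \<in> H")
      case True
      have "M.ord (\<ominus> \<one>) dvd 2"
        using M.pow_eq_id[of "\<ominus> \<one>" 2] True minus_one_square by (simp add: pow numeral_2_eq_2)
      moreover have "M.ord (\<ominus> \<one>) \<noteq> 1" using M.ord_eq_1[of "\<ominus> \<one>"] True m1 by simp
      ultimately have ord: "M.ord (\<ominus> \<one>) = 2"
        by (metis prime_nat_iff two_is_prime_nat)
      have "H = range (\<lambda>i::int. (\<ominus> \<one>) [^]\<^bsub>?M\<^esub> i)"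
      proof
        show "range (\<lambda>i::int. (\<ominus> \<one>) [^]\<^bsub>?M\<^esub> i) \<subseteq> H"
          using M.int_pow_closed[of "\<ominus> \<one>"] True by auto
        have "\<one> = (\<ominus> \<one>) [^]\<^bsub>?M\<^esub> (0::int)" "\<ominus> \<one> = (\<ominus> \<one>) [^]\<^bsub>?M\<^esub> (1::int)"
          using True M.int_pow_1[of "\<ominus> \<one>"] by simp_all
        then show "H \<subseteq> range (\<lambda>i::int. (\<ominus> \<one>) [^]\<^bsub>?M\<^esub> i)" using pm by blast
      qed
      then have "?M \<cong> integer_mod_group 2"
        using M.iso_integer_mod_group[of "\<ominus> \<one>" 2] True ord by simp
      then show ?thesis by blast
    next
      case False
      then have "H = {\<one>}" using pm one_in_H by blast
      then show ?thesis by blast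
    qed
  qed
qed

text \<open>In a group of order 2 all squares are trivial, so \<open>H\<close> lies in {1, -1}, and
  counting shows that these are two distinct elements of \<open>H\<close>.\<close>

lemma iso_integer_mod_group_2_imp:
  assumes iso: "(mult_of F)\<lparr>carrier := H\<rparr> \<cong> integer_mod_group 2"
  shows "H = {\<one>, \<ominus> \<one>}" "\<ominus> \<one> \<noteq> \<one>"
proof -
  let ?M = "(mult_of F)\<lparr>carrier := H\<rparr>"
  interpret M: group ?M
    using group.subgroup_imp_group[OF field_mult_group H] .
  have card: "card H = 2" using iso_same_card[OF iso] by (simp add: carrier_integer_mod_group)
  have "a = \<one> \<or> a = \<ominus> \<one>" if a: "a \<in> H" for a
  proof -
    have "a [^]\<^bsub>?M\<^esub> order ?M = \<one>" using M.pow_order_eq_1[of a] a by simp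
    then have "a \<otimes> a = \<one>" using card a H_carrier[OF a] by (simp add: order_def numeral_2_eq_2)
    then show ?thesis using square_eq_one_imp H_carrier[OF a] by blast
  qed
  then have sub: "H \<subseteq> {\<one>, \<ominus> \<one>}" by blast
  then show "\<ominus> \<one> \<noteq> \<one>" using card card_mono[of "{\<one>}" H] by auto
  then show "H = {\<one>, \<ominus> \<one>}" using card sub by (intro card_subset_eq) auto
qed

section \<open>The translation group\<close>

lemma carrier_trivial: "H = {\<one>} \<Longrightarrow> carrier (affine_subgroup F H) = aff \<one> ` carrier F"
  unfolding carrier_A by auto

lemma aff_one_pow:
  assumes "b \<in> carrier F"
  shows "aff \<one> b [^]\<^bsub>affine_subgroup F H\<^esub> (n::nat) = aff \<one> ([n] \<cdot> b)"
proof (induction n)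
  case (Suc n)
  then show ?case
    using assms by (simp add: A.nat_pow_Suc aff_mult a_comm del: nat_pow_Suc)
qed (simp add: one_A)

text \<open>An element of weight 1 generates this commutative group of odd order and so has order
  \<open>p ^ k\<close>, whereas every translation has order dividing \<open>p\<close>.\<close>

lemma trivial_lee_metric_imp_prime:
  assumes q: "card (carrier F) = p ^ k" "prime p" "odd (p ^ k)" and H1: "H = {\<one>}"
    and lee: "has_lee_metric (affine_subgroup F H)"
  shows "prime (p ^ k)"
proof -
  let ?A = "affine_subgroup F H"
  obtain w where w: "lee_weight ?A w"
    using lee unfolding A.has_lee_metric_iff by blast
  have "carrier ?A = aff \<one> ` carrier F" by (rule carrier_trivial[OF H1])
  then have card: "card (carrier ?A) = p ^ k"
    using q(1) by (simp add: card_image inj_on_def)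
  have finA: "finite (carrier ?A)" using card q(2) by (metis card.infinite power_not_zero not_prime_0)
  have comm: "x \<otimes>\<^bsub>?A\<^esub> y = y \<otimes>\<^bsub>?A\<^esub> x" if x: "x \<in> carrier ?A" and y: "y \<in> carrier ?A" for x y
  proof -
    obtain b where "x = aff \<one> b" "b \<in> carrier F" using A_cases[OF x] H1 by blast
    moreover obtain c where "y = aff \<one> c" "c \<in> carrier F" using A_cases[OF y] H1 by blast
    ultimately show ?thesis by (simp add: aff_commute_iff one_minus_one)
  qed
  have "aff \<one> \<one> \<in> carrier ?A" "aff \<one> \<one> \<noteq> \<one>\<^bsub>?A\<^esub>"
    using one_in_H by (auto simp: aff_in_A one_A)
  then have "aff \<one> \<one> \<in> carrier ?A" "1 \<le> w (aff \<one> \<one>)"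
    using A.lee_weight_eq_0_iff[OF w, of "aff \<one> \<one>"] by auto
  then obtain a where a: "a \<in> carrier ?A" "w a = 1"
    by (rule A.lee_weight_obtains[OF w])
  have "range (\<lambda>n::int. a [^]\<^bsub>?A\<^esub> n) = carrier ?A"
  proof (rule A.lee_weight_generates_if_odd_commutative[OF comm q(3) _ w a])
    show "x [^]\<^bsub>?A\<^esub> (p ^ k) = \<one>\<^bsub>?A\<^esub>" if "x \<in> carrier ?A" for x
      using A.pow_order_eq_1[OF that] by (simp add: order_def card)
  qed
  then have "generate ?A {a} = carrier ?A"
    using A.generate_pow[OF a(1)] by auto
  then have ord: "A.ord a = p ^ k" using A.generate_pow_card[OF a(1)] card by simp
  obtain b where b: "a = aff \<one> b" "b \<in> carrier F" using A_cases[OF a(1)] H1 by blast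
  have "a [^]\<^bsub>?A\<^esub> p = \<one>\<^bsub>?A\<^esub>"
    using aff_one_pow[OF b(2), of p] add_pow_prime_eq_zero[OF q(1) fin b(2)] unfolding b(1) one_A by simp
  then have "p ^ k dvd p ^ 1" using A.pow_eq_id[OF a(1), of p] ord by simp
  then have "k \<le> 1" using power_dvd_imp_le prime_gt_1_nat[OF q(2)] by blast
  moreover have "k \<noteq> 0"
  proof
    assume "k = 0"
    then have "card (carrier F) = 1" using q(1) by simp
    then obtain z where "carrier F = {z}" by (rule card_1_singletonE)
    then show False using zero_closed one_closed one_not_zero by (metis singletonD)
  qed
  ultimately have "k = 1" by simp
  then show ?thesis using q(2) by simp
qed

lemma trivial_has_lee_metric_even:
  assumes two: "\<one> \<oplus> \<one> = \<zero>" and H1: "H = {\<one>}"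
  shows "has_lee_metric (affine_subgroup F H)"
  unfolding A.has_lee_metric_iff
proof (rule A.lee_weight_if_exponent_two)
  have "carrier (affine_subgroup F H) = aff \<one> ` carrier F" by (rule carrier_trivial[OF H1])
  then show "finite (carrier (affine_subgroup F H))" using fin by simp
  fix x assume x: "x \<in> carrier (affine_subgroup F H)"
  obtain b where b: "x = aff \<one> b" "b \<in> carrier F" using A_cases[OF x] H1 by blast
  then show "x \<otimes>\<^bsub>affine_subgroup F H\<^esub> x = \<one>\<^bsub>affine_subgroup F H\<^esub>"
    using two by (simp add: aff_square_eq_one_iff)
qed

section \<open>Lee metrics over prime fields\<close>

text \<open>The additive order of 1 divides the prime \<open>p\<close> and is not 1, so the
  \<open>p\<close> multiples of 1 exhaust the field. The centred representatives serve as shortest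
  displacements.\<close>

lemma prime_field_multiples:
  assumes p: "card (carrier F) = p" "prime p"
  shows "\<And>i j :: int. [i] \<cdot> \<one> = [j] \<cdot> \<one> \<longleftrightarrow> int p dvd i - j"
    and "\<And>b. b \<in> carrier F \<Longrightarrow> odd p \<Longrightarrow> \<exists>i::int. b = [i] \<cdot> \<one> \<and> 2 * \<bar>i\<bar> < int p"
proof -
  have "[p] \<cdot> \<one> = \<zero>" using add_pow_prime_eq_zero[of p 1 \<one>] p(1) fin by simp
  then have "add.ord \<one> dvd p" using add.pow_eq_id[OF one_closed, of p] by simp
  moreover have "add.ord \<one> \<noteq> 1" using add.ord_eq_1[OF one_closed] by simp
  ultimately have ord: "add.ord \<one> = p" using p(2) by (metis prime_nat_iff)
  show eq: "[i] \<cdot> \<one> = [j] \<cdot> \<one> \<longleftrightarrow> int p dvd i - j" for i j :: int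
    using add.int_pow_eq[OF one_closed, of j i] ord by auto
  have "inj_on (\<lambda>i::int. [i] \<cdot> \<one>) {0..<int p}"
  proof
    fix i j assume ij: "i \<in> {0..<int p}" "j \<in> {0..<int p}" "[i] \<cdot> \<one> = [j] \<cdot> \<one>"
    then have "i mod int p = j mod int p" by (simp only: eq mod_eq_dvd_iff)
    then show "i = j" using ij(1,2) by (metis atLeastLessThan_iff mod_pos_pos_trivial)
  qed
  then have "card ((\<lambda>i::int. [i] \<cdot> \<one>) ` {0..<int p}) = p" by (simp add: card_image)
  moreover have "(\<lambda>i::int. [i] \<cdot> \<one>) ` {0..<int p} \<subseteq> carrier F" by auto
  ultimately have surj: "(\<lambda>i::int. [i] \<cdot> \<one>) ` {0..<int p} = carrier F"
    using p(1) fin by (intro card_subset_eq) simp_all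
  show "\<exists>i::int. b = [i] \<cdot> \<one> \<and> 2 * \<bar>i\<bar> < int p" if b: "b \<in> carrier F" and "odd p" for b
  proof -
    have "b \<in> (\<lambda>i::int. [i] \<cdot> \<one>) ` {0..<int p}" unfolding surj by (rule b)
    then obtain i where i: "i \<in> {0..<int p}" "b = [i] \<cdot> \<one>" by (rule imageE) (rule that)
    show ?thesis
    \<comment> \<open>A representative in the upper half is lowered by \<open>p\<close>; oddness of
      \<open>p\<close> excludes the midpoint.\<close>
    proof (cases "2 * i < int p")
      case True
      then show ?thesis using i by auto
    next
      case False
      moreover have "b = [(i - int p)] \<cdot> \<one>" unfolding i(2) eq by simp
      moreover have "2 * i \<noteq> int p" using \<open>odd p\<close> by (metis dvd_triv_left even_of_nat)
      ultimately show ?thesis using i(1) by (intro exI[of _ "i - int p"]) auto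
    qed
  qed
qed

lemma neg_multiple: "\<ominus> ([i] \<cdot> \<one>) = [(- i)] \<cdot> \<one>" for i :: int
  using add.int_pow_neg[OF one_closed] by simp

lemma add_multiple: "[i] \<cdot> \<one> \<oplus> [j] \<cdot> \<one> = [(i + j)] \<cdot> \<one>" for i j :: int
  using add.int_pow_mult[OF one_closed] by simp

lemma inv_translation:
  assumes "b \<in> carrier F"
  shows "inv\<^bsub>affine_subgroup F H\<^esub> (aff \<one> b) = aff \<one> (\<ominus> b)"
  by (rule A.inv_equality) (use assms one_in_H in \<open>auto simp: aff_mult one_A aff_in_A r_neg\<close>)

lemma inv_reflection:
  assumes "b \<in> carrier F" "\<ominus> \<one> \<in> H"
  shows "inv\<^bsub>affine_subgroup F H\<^esub> (aff (\<ominus> \<one>) b) = aff (\<ominus> \<one>) b"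
  by (rule A.inv_equality) (use assms minus_one_square in \<open>auto simp: aff_mult one_A aff_in_A l_minus l_neg\<close>)

text \<open>Translations act on the circle Z/p; \<open>N\<close> is the largest distance from the
  origin on it.\<close>

lemma trivial_has_lee_metric_prime:
  assumes p: "card (carrier F) = p" "prime p" "odd p" and H1: "H = {\<one>}"
  shows "has_lee_metric (affine_subgroup F H)"
  unfolding A.has_lee_metric_iff
proof (rule A.lee_weight_if_displacements)
  let ?A = "affine_subgroup F H"
  let ?P = "\<lambda>x (z::int). x = aff \<one> ([z] \<cdot> \<one>)"
  define N where "N = (p - 1) div 2"
  have N: "int p = 2 * int N + 1" using p(3) unfolding N_def by (auto elim!: oddE)
  note eq = prime_field_multiples(1)[OF p(1,2)]
  show "?P (g \<otimes>\<^bsub>?A\<^esub> h) (y + z) \<or> ?P (g \<otimes>\<^bsub>?A\<^esub> h) (y - z)" if "?P g y" "?P h z" for g h y z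
    using that by (simp add: aff_mult add_multiple add.commute)
  show "?P (inv\<^bsub>?A\<^esub> g) z \<or> ?P (inv\<^bsub>?A\<^esub> g) (- z)" if "?P g z" for g z
    using that by (simp add: inv_translation neg_multiple)
  show "\<exists>z. ?P g z \<and> \<bar>z\<bar> \<le> int N" if g: "g \<in> carrier ?A" for g
  proof -
    obtain b where "g = aff \<one> b" "b \<in> carrier F" using A_cases[OF g] H1 by blast
    then show ?thesis using prime_field_multiples(2)[OF p(1,2) _ p(3), of b] N by fastforce
  qed
  show "\<bar>y\<bar> = \<bar>z\<bar>" if g: "?P g y" "?P g z" "\<bar>y\<bar> \<le> int N" "\<bar>z\<bar> \<le> int N" for g y z
  proof -
    have "int p dvd y - z" using g(1,2) by (simp flip: eq)
    then show ?thesis using abs_congruent_eq[of "int p" y z] g(3,4) N by simp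
  qed
  show "h = g \<or> h = inv\<^bsub>?A\<^esub> g" if gh: "?P g y" "?P h z" "\<bar>y\<bar> = \<bar>z\<bar>" for g h y z
  proof -
    have "z = y \<or> z = - y" using gh(3) by linarith
    then show ?thesis using gh(1,2) by (auto simp: inv_translation neg_multiple)
  qed
  show "\<exists>g\<in>carrier ?A. ?P g (int k) \<or> ?P g (- int k)" if "k \<le> N" for k
    by (rule bexI[of _ "aff \<one> ([int k] \<cdot> \<one>)"]) (auto simp: aff_in_A one_in_H)
qed

text \<open>On the circle Z/3p, \<open>?r i\<close> acts as x + 3i and \<open>?s i\<close> as -x +
  3i - 1. The displacements 3i and -3i belong to mutually inverse translations. The displacements 3i
  - 1 of the reflections, which are their own inverses, represent each residue prime to 3 once up to
  sign. Thus every length up to \<open>N\<close> belongs to exactly one pair of inverses.\<close>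

lemma dihedral_has_lee_metric_prime:
  assumes p: "card (carrier F) = p" "prime p" "odd p" and H2: "H = {\<one>, \<ominus> \<one>}" "\<ominus> \<one> \<noteq> \<one>"
  shows "has_lee_metric (affine_subgroup F H)"
  unfolding A.has_lee_metric_iff
proof (rule A.lee_weight_if_displacements)
  let ?A = "affine_subgroup F H"
  let ?r = "\<lambda>i::int. aff \<one> ([i] \<cdot> \<one>)" and ?s = "\<lambda>i::int. aff (\<ominus> \<one>) ([i] \<cdot> \<one>)"
  let ?P = "\<lambda>x z. (\<exists>i. x = ?r i \<and> z = 3 * i) \<or> (\<exists>i. x = ?s i \<and> z = 3 * i - 1)"
  define N where "N = (3 * p - 1) div 2"
  have N: "3 * int p = 2 * int N + 1" using p(3) unfolding N_def by (auto elim!: oddE)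
  note eq = prime_field_multiples(1)[OF p(1,2)]
  have m1: "\<ominus> \<one> \<in> H" using H2 by simp
  have rr: "?r i \<otimes>\<^bsub>?A\<^esub> ?r j = ?r (i + j)" and rs: "?r i \<otimes>\<^bsub>?A\<^esub> ?s j = ?s (i + j)"
    and sr: "?s i \<otimes>\<^bsub>?A\<^esub> ?r j = ?s (i - j)" and ss: "?s i \<otimes>\<^bsub>?A\<^esub> ?s j = ?r (i - j)" for i j
    using minus_one_square by (simp_all add: aff_mult l_minus neg_multiple add_multiple add.commute)
  have ir: "inv\<^bsub>?A\<^esub> (?r i) = ?r (- i)" and is': "inv\<^bsub>?A\<^esub> (?s i) = ?s i" for i
    using m1 by (simp_all add: inv_translation inv_reflection neg_multiple)
  show "?P (g \<otimes>\<^bsub>?A\<^esub> h) (y + z) \<or> ?P (g \<otimes>\<^bsub>?A\<^esub> h) (y - z)" if g: "?P g y" and h: "?P h z" for g h y z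
    using g
  proof (elim disjE exE conjE)
    fix i assume g: "g = ?r i" "y = 3 * i"
    have "?P (g \<otimes>\<^bsub>?A\<^esub> h) (y + z)"
      using h
    proof (elim disjE exE conjE)
      fix j assume "h = ?r j" "z = 3 * j"
      then show ?thesis using g by (intro disjI1 exI[of _ "i + j"]) (simp only: rr, simp)
    next
      fix j assume "h = ?s j" "z = 3 * j - 1"
      then show ?thesis using g by (intro disjI2 exI[of _ "i + j"]) (simp only: rs, simp)
    qed
    then show ?thesis by blast
  next
    fix i assume g: "g = ?s i" "y = 3 * i - 1"
    have "?P (g \<otimes>\<^bsub>?A\<^esub> h) (y - z)"
      using h
    proof (elim disjE exE conjE)
      fix j assume "h = ?r j" "z = 3 * j"
      then show ?thesis using g by (intro disjI2 exI[of _ "i - j"]) (simp only: sr, simp)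
    next
      fix j assume "h = ?s j" "z = 3 * j - 1"
      then show ?thesis using g by (intro disjI1 exI[of _ "i - j"]) (simp only: ss, simp)
    qed
    then show ?thesis by blast
  qed
  show "?P (inv\<^bsub>?A\<^esub> g) z \<or> ?P (inv\<^bsub>?A\<^esub> g) (- z)" if "?P g z" for g z
    using that
  proof (elim disjE exE conjE)
    fix i assume "g = ?r i" "z = 3 * i"
    then have "?P (inv\<^bsub>?A\<^esub> g) (- z)" by (intro disjI1 exI[of _ "- i"]) (simp only: ir, simp)
    then show ?thesis by blast
  next
    fix i assume "g = ?s i" "z = 3 * i - 1"
    then have "?P (inv\<^bsub>?A\<^esub> g) z" by (intro disjI2 exI[of _ i] conjI) (simp_all only: is')
    then show ?thesis by blast
  qed
  show "\<exists>z. ?P g z \<and> \<bar>z\<bar> \<le> int N" if g: "g \<in> carrier ?A" for g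
  proof -
    obtain a b where ab: "g = aff a b" "a = \<one> \<or> a = \<ominus> \<one>" "b \<in> carrier F" using A_cases[OF g] H2 by blast
    obtain i :: int where i: "b = [i] \<cdot> \<one>" "2 * \<bar>i\<bar> < int p"
      using prime_field_multiples(2)[OF p(1,2) ab(3) p(3)] by blast
    have "3 * \<bar>i\<bar> + 1 \<le> int N" using i(2) N by linarith
    then have "\<bar>3 * i\<bar> \<le> int N" "\<bar>3 * i - 1\<bar> \<le> int N" by linarith+
    then show ?thesis using ab i(1) by blast
  qed
  \<comment> \<open>Congruence of \<open>i\<close> and \<open>j\<close> modulo \<open>p\<close>
    becomes congruence of displacements modulo 3p. The constant \<open>c\<close> is 0 for
    translations and 1 for reflections.\<close>
  have r_eq: "i = j" if "?r i = ?r j \<or> ?s i = ?s j" "2 * \<bar>3 * i - c\<bar> < 3 * int p" "2 * \<bar>3 * j - c\<bar> < 3 * int p" for i j c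
  proof -
    have "int p dvd i - j" using that(1) by (auto simp: eq)
    then have "3 * int p dvd 3 * (i - j)" by (rule mult_dvd_mono[OF dvd_refl])
    then have "3 * int p dvd (3 * i - c) - (3 * j - c)" by (simp add: algebra_simps)
    then show ?thesis using abs_congruent_eq[of "3 * int p" "3 * i - c" "3 * j - c"] that by simp
  qed
  have rs_ne: "?r i \<noteq> ?s j" "?s j \<noteq> ?r i" for i j using H2(2) by auto
  show "\<bar>y\<bar> = \<bar>z\<bar>" if P: "?P g y" "?P g z" and le: "\<bar>y\<bar> \<le> int N" "\<bar>z\<bar> \<le> int N" for g y z
    using P
  proof (elim disjE exE conjE)
    fix i j assume "g = ?r i" "y = 3 * i" "g = ?r j" "z = 3 * j"
    then show ?thesis using r_eq[of i j 0] le N by simp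
  next
    fix i j assume "g = ?s i" "y = 3 * i - 1" "g = ?s j" "z = 3 * j - 1"
    then show ?thesis using r_eq[of i j 1] le N by simp
  qed (use rs_ne in blast)+
  show "h = g \<or> h = inv\<^bsub>?A\<^esub> g" if P: "?P g y" "?P h z" and yz: "\<bar>y\<bar> = \<bar>z\<bar>" for g h y z
    using P
  proof (elim disjE exE conjE)
    fix i j assume gh: "g = ?r i" "y = 3 * i" "h = ?r j" "z = 3 * j"
    then have "j = i \<or> j = - i" using yz by linarith
    then show ?thesis unfolding gh ir by blast
  next
    fix i j assume gh: "g = ?s i" "y = 3 * i - 1" "h = ?s j" "z = 3 * j - 1"
    \<comment> \<open>Opposite signs would give 3(i + j) = 2.\<close>
    then have "j = i" using yz by presburger
    then show ?thesis unfolding gh by blast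
  next
    fix i j assume "y = 3 * i" "z = 3 * j - 1"
    then show ?thesis using yz by presburger
  next
    fix i j assume "y = 3 * i - 1" "z = 3 * j"
    then show ?thesis using yz by presburger
  qed
  show "\<exists>g\<in>carrier ?A. ?P g (int k) \<or> ?P g (- int k)" if "k \<le> N" for k
  proof -
    have rA: "?r i \<in> carrier ?A" "?s i \<in> carrier ?A" for i
      using one_in_H m1 by (simp_all add: aff_in_A)
    \<comment> \<open>The residues 0, 2 and 1 of \<open>k\<close> modulo 3, in this order; the last
      is reached by a reflection with displacement -k.\<close>
    have "(\<exists>i. int k = 3 * i) \<or> (\<exists>i. int k = 3 * i - 1) \<or> (\<exists>i. - int k = 3 * i - 1)"
      by presburger
    then show ?thesis using rA by blast
  qed
qed

end

theorem proposition4p7: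
  fixes F :: "('a, 'm) ring_scheme" (structure) and q :: nat
  assumes "field F" and "finite (carrier F)" and "card (carrier F) = q"
    and "primepow q" and "q \<noteq> 2" and "q \<noteq> 3" and "q \<noteq> 5"
  shows "\<not> has_lee_metric (affine_group F) \<and>
    (\<forall>H. subgroup H (mult_of F) \<longrightarrow>
      (even q \<longrightarrow> (has_lee_metric (affine_subgroup F H) \<longleftrightarrow> H = {\<one>})) \<and>
      (odd q \<longrightarrow>
        (H = {\<one>} \<longrightarrow> (has_lee_metric (affine_subgroup F H) \<longleftrightarrow> prime q)) \<and>
        ((mult_of F)\<lparr>carrier := H\<rparr> \<cong> integer_mod_group 2 \<and> prime q \<longrightarrow>
          has_lee_metric (affine_subgroup F H)) \<and>
        (H \<noteq> {\<one>} \<and>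
         \<not> (mult_of F)\<lparr>carrier := H\<rparr> \<cong> integer_mod_group 2 \<and>
         \<not> (mult_of F)\<lparr>carrier := H\<rparr> \<cong> integer_mod_group 4 \<longrightarrow>
          \<not> has_lee_metric (affine_subgroup F H))))"
    (is "_ \<and> (\<forall>H. _ \<longrightarrow> ?classification H)")
proof -
  interpret field F by fact
  obtain p k where pk: "prime p" "k > 0" "q = p ^ k"
    using \<open>primepow q\<close> unfolding primepow_def by blast
  have aff: "affine_field F H" if "subgroup H (mult_of F)" for H
    using that assms(1,2) by (simp add: affine_field_def affine_field_axioms_def)
  have two: "\<one> \<oplus> \<one> = \<zero> \<longleftrightarrow> even q"
  proof
    assume "even q"
    then have "p = 2" using pk primes_dvd_imp_eq[OF two_is_prime_nat pk(1)]
      by (metis prime_dvd_power two_is_prime_nat)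
    then show "\<one> \<oplus> \<one> = \<zero>"
      using add_pow_prime_eq_zero[of p k \<one>] assms(2,3) pk(3) by (simp add: numeral_2_eq_2)
  next
    assume z: "\<one> \<oplus> \<one> = \<zero>"
    have "[(2::nat)] \<cdot> \<one> = \<zero>" using z by (simp add: numeral_2_eq_2)
    then have "add.ord \<one> dvd 2" using add.pow_eq_id[OF one_closed, of 2] by simp
    moreover have "add.ord \<one> \<noteq> 1" using add.ord_eq_1[OF one_closed] by simp
    ultimately have "add.ord \<one> = 2" by (metis prime_nat_iff two_is_prime_nat)
    then show "even q" using add.ord_dvd_group_order[OF one_closed] assms(3) by (simp add: order_def)
  qed
  have cls: "?classification H" if H: "subgroup H (mult_of F)" for H
  proof -
    interpret affine_field F H by (rule aff[OF H])
    have "has_lee_metric (affine_subgroup F H) \<longleftrightarrow> H = {\<one>}" if "even q"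
      using no_lee_metric_char_two trivial_has_lee_metric_even two that by blast
    moreover have "has_lee_metric (affine_subgroup F H) \<longleftrightarrow> prime q" if "odd q" "H = {\<one>}"
      using trivial_lee_metric_imp_prime[of p k] trivial_has_lee_metric_prime[of q] that assms(3) pk by metis
    moreover have "has_lee_metric (affine_subgroup F H)"
      if "odd q" "prime q" "(mult_of F)\<lparr>carrier := H\<rparr> \<cong> integer_mod_group 2"
      using dihedral_has_lee_metric_prime[of q] iso_integer_mod_group_2_imp that assms(3) by blast
    \<comment> \<open>Contrapositively, outside the three isomorphism types some element of
      \<open>H\<close> has a nontrivial fourth power.\<close>
    moreover have "\<not> has_lee_metric (affine_subgroup F H)"
      if "odd q" "H \<noteq> {\<one>}" "\<not> (mult_of F)\<lparr>carrier := H\<rparr> \<cong> integer_mod_group 2"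
        "\<not> (mult_of F)\<lparr>carrier := H\<rparr> \<cong> integer_mod_group 4"
      using fourth_roots_of_unity_cases no_lee_metric_char_odd two that by blast
    ultimately show ?thesis by blast
  qed
  let ?U = "carrier (mult_of F)"
  have U: "subgroup ?U (mult_of F)"
    by (rule group.subgroup_self[OF field_mult_group])
  \<comment> \<open>The excluded values 2, 3 and 5 of \<open>q\<close> are those for which the full
    multiplicative group has order 1, 2 or 4, so the classification denies a Lee metric for either
    parity of \<open>q\<close>.\<close>
  have cardU: "card ?U = q - 1" using assms(2,3) by simp
  have q1: "q > 1" using primepow_gt_Suc_0[OF \<open>primepow q\<close>] by simp
  have iso: "card ?U = n" if "(mult_of F)\<lparr>carrier := ?U\<rparr> \<cong> integer_mod_group n" "n > 0" for n
    using iso_same_card[OF that(1)] that(2) by (simp add: carrier_integer_mod_group)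
  have "card ?U \<noteq> card {\<one>}" unfolding cardU using q1 \<open>q \<noteq> 2\<close> by simp
  then have "?U \<noteq> {\<one>}" by metis
  moreover have "\<not> (mult_of F)\<lparr>carrier := ?U\<rparr> \<cong> integer_mod_group 2"
    "\<not> (mult_of F)\<lparr>carrier := ?U\<rparr> \<cong> integer_mod_group 4"
    using iso[of 2] iso[of 4] cardU \<open>q \<noteq> 3\<close> \<open>q \<noteq> 5\<close> by auto
  ultimately have "\<not> has_lee_metric (affine_group F)"
    unfolding affine_group_def using cls[OF U] by blast
  then show ?thesis using cls by blast
qed

end
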